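(* Let $d_1\ge2$ and $d_2\ge1$ be integers and let $\boldsymbol\kappa=(\kappa_1,\dots,\kappa_{d_2})\in\mathbb{R}^{d_2}$ with $\kappa_1,\dots,\kappa_{d_2-1}>-1$ and $\kappa_{d_2}=-1$. For functions on $\mathbb{S}^{d_1-1}\rtimes\mathbb{R}_\Sigma^{d_2}$ define the differential operator $$ \mathfrak{D}_{\boldsymbol\kappa}^{\mathbb{S}\rtimes\Sigma}:=\sum_{i=1}^{d_2}\big(y_i\partial_{y_i}^2+(\kappa_i+1-y_i)\partial_{y_i}\big)-2\langle y,\nabla_y\rangle\partial_{y_{d_2}}+2|y|\partial_{y_{d_2}}^2-(|\boldsymbol\kappa|-d_1+d_2+1)\partial_{y_{d_2}}+\frac1{|y|}\Delta_0^{(x)} . $$ Then, for every $n\in\mathbb{N}_0$, $$ \mathfrak{D}_{\boldsymbol\kappa}^{\mathbb{S}\rtimes\Sigma}u=-n\,u\qquad\text{for all }u\in\mathcal{V}_n\big(\mathbb{S}^{d_1-1}\rtimes\mathbb{R}_\Sigma^{d_2},\mathsf{W}_{\boldsymbol\kappa}^{\mathbb{S}\rtimes\Sigma}\big). $$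
   Context: Variables are $(x,y)\in\mathbb{R}^{d_1}\times\mathbb{R}^{d_2}$; $|y|=y_1+\dots+y_{d_2}$ (signed sum), $|y'|=y_1+\dots+y_{d_2-1}$, $|\boldsymbol\kappa|=\kappa_1+\dots+\kappa_{d_2}$ (including $\kappa_{d_2}=-1$), $\langle y,\nabla_y\rangle\partial_{y_{d_2}}=\sum_iy_i\partial_{y_i}\partial_{y_{d_2}}$. $\mathbb{R}_\Sigma^{d}=\{y\in\mathbb{R}^d:y_1\ge0,\dots,y_{d-1}\ge0,\ |y|\ge0\}$. The surface is $\mathbb{S}^{d_1-1}\rtimes\mathbb{R}_\Sigma^{d_2}=\{(x,y)\in\mathbb{R}^{d_1}\times\mathbb{R}_\Sigma^{d_2}:\|x\|=|y|\}$ with surface measure $\mathrm{d}\sigma$, and the weight is $\mathsf{W}_{\boldsymbol\kappa}^{\mathbb{S}\rtimes\Sigma}(y)=\prod_{i=1}^{d_2-1}y_i^{\kappa_i}\,|y|^{\kappa_{d_2}}e^{-|y'|-|y|}$. $\mathcal{V}_n(\cdot,\mathsf{W})$ is the space of restrictions to the surface of polynomials in $d_1+d_2$ variables of degree at most $n$ that are orthogonal to all restrictions of polynomials of degree less than $n$ with respect to $\int fg\,\mathsf{W}\,\mathrm{d}\sigma$. The operators act on functions on the surface through the parametrization $x=|y|\xi$, $\xi\in\mathbb{S}^{d_1-1}$, $y\in\mathbb{R}_\Sigma^{d_2}$ (with $|y|>0$): a function $u$ is regarded as a function of $(\xi,y)$, the derivatives $\partial_{y_i}$ are taken with $\xi$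 fixed, and $\Delta_0^{(x)}$ is the Laplace–Beltrami operator of $\mathbb{S}^{d_1-1}$ acting on $\xi=x/\|x\|$ with $y$ fixed. *)

theory Defs
  imports "HOL-Analysis.Analysis"
begin

text \<open>
  \<open>x \<in> real ^ 'a\<close> and \<open>y \<in> real ^ 'b\<close>, so \<open>d\<^sub>1 = CARD('a)\<close> and \<open>d\<^sub>2 = CARD('b)\<close>.  The index of
  the distinguished last coordinate \<open>y\<^bsub>d\<^sub>2\<^esub>\<close> is an explicit parameter \<open>l :: 'b\<close>; the indices
  \<open>1, ..., d\<^sub>2 - 1\<close> are the elements of \<open>UNIV - {l}\<close>, an empty set if \<open>d\<^sub>2 = 1\<close>.
\<close>

definition coord_sum :: "real ^ 'b \<Rightarrow> real"
  where "coord_sum y = (\<Sum>i\<in>UNIV. y $ i)"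

definition R_Sigma :: "'b \<Rightarrow> (real ^ 'b) set"
  where "R_Sigma l = {y. (\<forall>i. i \<noteq> l \<longrightarrow> 0 \<le> y $ i) \<and> 0 \<le> coord_sum y}"

definition surf :: "'b \<Rightarrow> ((real ^ 'a) \<times> (real ^ 'b)) set"
  where "surf l = {(x, y). y \<in> R_Sigma l \<and> norm x = coord_sum y}"

text \<open>
  The hypersurface \<open>\<parallel>x\<parallel> = |y|\<close> is the graph of
  \<open>\<phi> (x, y') = \<parallel>x\<parallel> - (\<Sum>i\<noteq>l. y'\<^sub>i)\<close> over \<open>(x, y')\<close>, so its surface
  measure is the image of \<open>sqrt (1 + \<parallel>\<nabla>\<phi>\<parallel>\<^sup>2) dx dy'\<close> under the graph map.  For \<open>x \<noteq> 0\<close> we have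
  \<open>\<parallel>\<nabla>\<phi>\<parallel>\<^sup>2 = 1 + (d\<^sub>2 - 1) = d\<^sub>2\<close>.  In the coordinates \<open>x = |y| \<xi>\<close> the measure is
  \<open>sqrt (1 + d\<^sub>2) |y|^(d\<^sub>1 - 1) d\<sigma>(\<xi>) dy\<close>.
\<close>

definition graph_map :: "'b \<Rightarrow> (real ^ 'a) \<times> ('b \<Rightarrow> real) \<Rightarrow> (real ^ 'a) \<times> (real ^ 'b)"
  where "graph_map l = (\<lambda>(x, \<eta>).
    (x, \<chi> j. if j = l then norm x - (\<Sum>i\<in>UNIV - {l}. \<eta> i) else \<eta> j))"

definition surface_measure :: "'b \<Rightarrow> ((real ^ 'a) \<times> (real ^ 'b)) measure"
  where "surface_measure l = scale_measure (ennreal (sqrt (1 + real CARD('b))))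
    (distr (lborel \<Otimes>\<^sub>M (\<Pi>\<^sub>M i\<in>UNIV - {l}. lborel)) borel (graph_map l))"

lemma measurable_graph_map:
  "graph_map l \<in> measurable (lborel \<Otimes>\<^sub>M (\<Pi>\<^sub>M i\<in>UNIV - {l}. lborel))
     (borel :: ((real ^ 'a) \<times> (real ^ 'b)) measure)"
proof -
  let ?M = "(lborel :: (real ^ 'a) measure) \<Otimes>\<^sub>M (\<Pi>\<^sub>M i\<in>UNIV - {l::'b}. (lborel :: real measure))"
  let ?f = "\<lambda>p. \<chi> j. if j = l then norm (fst p) - (\<Sum>i\<in>UNIV - {l}. snd p i) else snd p j"
  have fst: "(\<lambda>p. fst p) \<in> borel_measurable ?M"
    using measurable_fst[of "lborel :: (real ^ 'a) measure"] by simp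
  have snd: "(\<lambda>p. snd p i) \<in> borel_measurable ?M" if "i \<noteq> l" for i
  proof -
    have "(\<lambda>\<eta>. \<eta> i) \<in> measurable (\<Pi>\<^sub>M i\<in>UNIV - {l}. (lborel :: real measure)) lborel"
      using that by (intro measurable_component_singleton) simp
    from measurable_compose[OF measurable_snd this] show ?thesis by simp
  qed
  have comp: "(\<lambda>p. ?f p $ j) \<in> borel_measurable ?M" for j
  proof (cases "j = l")
    case True
    have "(\<lambda>p. norm (fst p) - (\<Sum>i\<in>UNIV - {l}. snd p i)) \<in> borel_measurable ?M"
      using fst snd by (intro borel_measurable_diff borel_measurable_sum borel_measurable_norm) auto
    with True show ?thesis by simp
  next
    case False
    with snd show ?thesis by simp
  qed
  have "?f \<in> borel_measurable ?M"
  proof (subst borel_measurable_euclidean_space, intro ballI)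
    fix b :: "real ^ 'b" assume "b \<in> Basis"
    then obtain j where "b = axis j 1" by (auto simp: Basis_vec_def)
    then show "(\<lambda>p. ?f p \<bullet> b) \<in> borel_measurable ?M"
      using comp[of j] by (simp only: inner_axis inner_real_def mult_1_right)
  qed
  then have "(\<lambda>p. (fst p, ?f p)) \<in> borel_measurable ?M"
    by (intro borel_measurable_Pair fst)
  then show ?thesis
    unfolding graph_map_def case_prod_beta .
qed

definition weight :: "real ^ 'b \<Rightarrow> 'b \<Rightarrow> real ^ 'b \<Rightarrow> real"
  where "weight \<kappa> l y = (\<Prod>i\<in>UNIV - {l}. (y $ i) powr (\<kappa> $ i)) * coord_sum y powr (\<kappa> $ l)
    * exp (- (\<Sum>i\<in>UNIV - {l}. y $ i) - coord_sum y)"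

text \<open>Polynomials in \<open>d\<^sub>1 + d\<^sub>2\<close> variables, of total degree at most \<open>n\<close>.\<close>

definition multi_indices :: "nat \<Rightarrow> (('a::finite \<Rightarrow> nat) \<times> ('b::finite \<Rightarrow> nat)) set"
  where "multi_indices n = {(\<alpha>, \<beta>). sum \<alpha> UNIV + sum \<beta> UNIV \<le> n}"

lemma finite_multi_indices:
  "finite (multi_indices n :: (('a::finite \<Rightarrow> nat) \<times> ('b::finite \<Rightarrow> nat)) set)"
proof -
  let ?B = "((UNIV :: 'a set) \<rightarrow>\<^sub>E {..n}) \<times> ((UNIV :: 'b set) \<rightarrow>\<^sub>E {..n})"
  have "(\<alpha>, \<beta>) \<in> ?B" if "(\<alpha>, \<beta>) \<in> multi_indices n" for \<alpha> :: "'a \<Rightarrow> nat" and \<beta> :: "'b \<Rightarrow> nat"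
  proof -
    from that have le: "sum \<alpha> UNIV + sum \<beta> UNIV \<le> n" by (simp add: multi_indices_def)
    have "\<alpha> i \<le> n" for i
      using member_le_sum[of i UNIV \<alpha>] le by simp
    moreover have "\<beta> j \<le> n" for j
      using member_le_sum[of j UNIV \<beta>] le by simp
    ultimately show ?thesis by auto
  qed
  then have "multi_indices n \<subseteq> ?B" by auto
  moreover have "finite ?B"
    by (intro finite_cartesian_product finite_PiE) auto
  ultimately show ?thesis by (rule finite_subset)
qed

definition polynomials :: "nat \<Rightarrow> ((real ^ 'a) \<times> (real ^ 'b) \<Rightarrow> real) set"
  where "polynomials n = {P. \<exists>c. P = (\<lambda>(x, y).
    \<Sum>(\<alpha>, \<beta>)\<in>multi_indices n.
      c \<alpha> \<beta> * (\<Prod>i\<in>UNIV. (x $ i) ^ \<alpha> i) * (\<Prod>j\<in>UNIV. (y $ j) ^ \<beta> j))}"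

text \<open>Functions on the surface are represented as extensional functions (\<open>restrict\<close>).\<close>

definition orth_polys ::
  "nat \<Rightarrow> 'b \<Rightarrow> (real ^ 'b \<Rightarrow> real) \<Rightarrow> ((real ^ 'a) \<times> (real ^ 'b) \<Rightarrow> real) set"
  where "orth_polys n l w = {restrict P (surf l) | P. P \<in> polynomials n \<and>
    (\<forall>m<n. \<forall>Q\<in>polynomials m.
      set_lebesgue_integral (surface_measure l) (surf l) (\<lambda>p. P p * Q p * w (snd p)) = 0)}"

text \<open>
  Partial derivative of a function on \<open>S\<close>; one-sided at boundary points of \<open>S\<close>.  At every
  \<open>y \<in> R_Sigma l\<close> with \<open>coord_sum y > 0\<close>, each coordinate line meets \<open>R_Sigma l\<close> in a nondegenerate
  interval, so the derivative within \<open>R_Sigma l\<close> is unique.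
\<close>

definition pdiff :: "(real ^ 'k) set \<Rightarrow> 'k \<Rightarrow> (real ^ 'k \<Rightarrow> real) \<Rightarrow> real ^ 'k \<Rightarrow> real"
  where "pdiff S i f y = vector_derivative (\<lambda>t. f (y + t *\<^sub>R axis i 1))
    (at 0 within {t. y + t *\<^sub>R axis i 1 \<in> S})"

text \<open>
  Laplace--Beltrami operator of the unit sphere: the Euclidean Laplacian of the extension
  \<open>z \<mapsto> f (z / \<parallel>z\<parallel>)\<close>, homogeneous of degree \<open>0\<close>, evaluated on the sphere.
\<close>

definition laplace_beltrami :: "(real ^ 'a \<Rightarrow> real) \<Rightarrow> real ^ 'a \<Rightarrow> real"
  where "laplace_beltrami f \<xi> =
    (\<Sum>i\<in>UNIV. pdiff UNIV i (pdiff UNIV i (\<lambda>z. f (z /\<^sub>R norm z))) \<xi>)"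

text \<open>
  Below, \<open>U\<close> is \<open>u\<close> as a function of \<open>y\<close> with \<open>\<xi> = x / \<parallel>x\<parallel>\<close> fixed.  The operator is
  meaningful at \<open>(x, y) \<in> surf l\<close> with \<open>coord_sum y > 0\<close>, and there it depends only on the
  values of \<open>u\<close> on \<open>surf l\<close>.
\<close>

definition D_op ::
  "real ^ 'b \<Rightarrow> 'b \<Rightarrow> ((real ^ 'a) \<times> (real ^ 'b) \<Rightarrow> real) \<Rightarrow> (real ^ 'a) \<times> (real ^ 'b) \<Rightarrow> real"
  where "D_op \<kappa> l u = (\<lambda>(x, y).
    let \<xi> = x /\<^sub>R norm x;
        U = (\<lambda>\<eta>. u (coord_sum \<eta> *\<^sub>R \<xi>, \<eta>));
        d = pdiff (R_Sigma l)
    in (\<Sum>i\<in>UNIV. y $ i * d i (d i U) y + (\<kappa> $ i + 1 - y $ i) * d i U y)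
       - 2 * (\<Sum>i\<in>UNIV. y $ i * d i (d l U) y)
       + 2 * coord_sum y * d l (d l U) y
       - (coord_sum \<kappa> - real CARD('a) + real CARD('b) + 1) * d l U y
       + 1 / coord_sum y * laplace_beltrami (\<lambda>\<zeta>. u (coord_sum y *\<^sub>R \<zeta>, y)) \<xi>)"

end

theory Submission
  imports Defs
begin

text \<open>
  On the surface put \<open>t = |y| = \<parallel>x\<parallel>\<close> and use the coordinates \<open>(x, y')\<close> with
  \<open>y' = (y\<^sub>i)\<close>, \<open>i \<noteq> l\<close>.  Since \<open>y\<^sub>l = t - |y'|\<close>, the partial derivatives in the old coordinates
  are \<open>\<partial>\<^sub>t\<close> for the index \<open>l\<close> and \<open>\<partial>\<^sub>i + \<partial>\<^sub>t\<close> for the others, and all mixed second derivatives cancel: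
  the operator is the sum of the Laguerre operators \<open>y\<^sub>j \<partial>\<^sub>j\<^sup>2 + (\<kappa>\<^sub>j + 1 - y\<^sub>j) \<partial>\<^sub>j\<close>, \<open>j \<noteq> l\<close>, and of
  \<open>t \<partial>\<^sub>t\<^sup>2 + (d\<^sub>1 - 1 - t) \<partial>\<^sub>t + \<Delta>\<^sub>0 / t\<close>, which in the variable \<open>x\<close> is \<open>\<parallel>x\<parallel> \<Delta> - x \<cdot> \<nabla>\<close>.  In the same
  coordinates the weighted surface measure is, up to a factor, the product of \<open>e\<^bsup>-\<parallel>x\<parallel>\<^esup> / \<parallel>x\<parallel> dx\<close> and of the
  Gamma densities \<open>y\<^sub>j\<^bsup>\<kappa>\<^sub>j\<^esup> e\<^bsup>-y\<^sub>j\<^esup>\<close>, and each summand is symmetric for its own factor; for the first one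
  because \<open>(\<parallel>x\<parallel> \<Delta> - x \<cdot> \<nabla>) f = \<parallel>x\<parallel> e\<^bsup>\<parallel>x\<parallel>\<^esup> div (e\<^bsup>-\<parallel>x\<parallel>\<^esup> \<nabla>f)\<close>.

  The adapted monomials \<open>x\<^sup>\<alpha> t\<^bsup>\<beta>\<^sub>l\<^esup> \<Prod>\<^bsub>j \<noteq> l\<^esub> y\<^sub>j\<^bsup>\<beta>\<^sub>j\<^esup>\<close> (\<open>amonom\<close>) span the polynomials of each degree, and
  the operator maps such a monomial to minus its degree times itself plus monomials of smaller degree
  (\<open>D_op_amonoms\<close>, \<open>gen_monom\<close>).  Hence \<open>D + n\<close> maps polynomials of degree at most \<open>n\<close> to polynomials of
  degree at most \<open>n - 1\<close>.  Symmetry (\<open>gen_form_commute\<close>) is an identity between moments of the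
  weight; it follows from the recursion of the Gamma function and from one integration by parts in
  \<open>x\<close> (\<open>radial_moment_by_parts\<close>).

  Now let \<open>u\<close> be orthogonal to all polynomials of degree less than \<open>n\<close> and put \<open>r = D u + n u\<close>.  As \<open>r\<close> and
  \<open>D r + n r\<close> have degree at most \<open>n - 1\<close>, symmetry gives \<open>\<langle>r, r\<rangle> = \<langle>u, D r + n r\<rangle> = 0\<close>.  The weight is
  positive almost everywhere on the surface and \<open>r\<close> is continuous, so \<open>r\<close> vanishes at every point of the
  surface with \<open>|y| > 0\<close> (\<open>vanishes_if_weighted_square_integral_eq_0\<close>).
\<close>

section \<open>Monomials and polynomials in two groups of variables\<close>

definition vmonom :: "('k::finite \<Rightarrow> nat) \<Rightarrow> real ^ 'k \<Rightarrow> real"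
  where "vmonom \<alpha> x = (\<Prod>i\<in>UNIV. (x $ i) ^ \<alpha> i)"

lemma vmonom_zero [simp]: "vmonom (\<lambda>_. 0) x = 1"
  by (simp add: vmonom_def)

lemma vmonom_add: "vmonom (\<lambda>i. \<alpha> i + \<beta> i) x = vmonom \<alpha> x * vmonom \<beta> x"
  by (simp add: vmonom_def power_add prod.distrib)

lemma vmonom_split: "vmonom \<alpha> x = (x $ i) ^ \<alpha> i * (\<Prod>j\<in>UNIV - {i}. (x $ j) ^ \<alpha> j)"
  unfolding vmonom_def by (rule prod.remove) auto

lemma vmonom_upd: "vmonom (\<alpha>(i := k)) x = (x $ i) ^ k * (\<Prod>j\<in>UNIV - {i}. (x $ j) ^ \<alpha> j)"
proof -
  have "vmonom (\<alpha>(i := k)) x = (x $ i) ^ k * (\<Prod>j\<in>UNIV - {i}. (x $ j) ^ (\<alpha>(i := k)) j)"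
    by (subst vmonom_split[of _ _ i]) simp
  also have "(\<Prod>j\<in>UNIV - {i}. (x $ j) ^ (\<alpha>(i := k)) j) = (\<Prod>j\<in>UNIV - {i}. (x $ j) ^ \<alpha> j)"
    by (rule prod.cong) auto
  finally show ?thesis .
qed

lemma vmonom_scale: "vmonom \<alpha> (c *\<^sub>R x) = c ^ sum \<alpha> UNIV * vmonom \<alpha> x"
  by (simp add: vmonom_def power_mult_distrib prod.distrib power_sum)

lemma continuous_on_vmonom [continuous_intros]:
  "continuous_on S f \<Longrightarrow> continuous_on S (\<lambda>z. vmonom \<alpha> (f z))"
  unfolding vmonom_def by (intro continuous_intros) auto

lemma sum_upd:
  fixes \<alpha> :: "'k::finite \<Rightarrow> nat"
  shows "sum (\<alpha>(i := k)) UNIV + \<alpha> i = sum \<alpha> UNIV + k"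
proof -
  have "sum (\<alpha>(i := k)) UNIV = k + sum \<alpha> (UNIV - {i})"
    by (subst sum.remove[of _ i]) (auto intro: sum.cong)
  moreover have "sum \<alpha> UNIV = \<alpha> i + sum \<alpha> (UNIV - {i})"
    by (rule sum.remove) auto
  ultimately show ?thesis by simp
qed

lemma polynomials_eq:
  "(polynomials n :: ((real ^ 'a) \<times> (real ^ 'b) \<Rightarrow> real) set) =
    {P. \<exists>c. P = (\<lambda>p. \<Sum>i\<in>multi_indices n. c i * (vmonom (fst i) (fst p) * vmonom (snd i) (snd p)))}"
  (is "_ = ?R")
proof (intro set_eqI iffI)
  fix P :: "(real ^ 'a) \<times> (real ^ 'b) \<Rightarrow> real" assume "P \<in> polynomials n"
  then obtain c where P: "P = (\<lambda>(x, y). \<Sum>(\<alpha>, \<beta>)\<in>multi_indices n.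
      c \<alpha> \<beta> * (\<Prod>i\<in>UNIV. (x $ i) ^ \<alpha> i) * (\<Prod>j\<in>UNIV. (y $ j) ^ \<beta> j))"
    unfolding polynomials_def by blast
  have "P = (\<lambda>p. \<Sum>i\<in>multi_indices n.
      (\<lambda>(\<alpha>, \<beta>). c \<alpha> \<beta>) i * (vmonom (fst i) (fst p) * vmonom (snd i) (snd p)))"
    unfolding P by (auto simp: fun_eq_iff case_prod_beta vmonom_def mult_ac)
  then show "P \<in> ?R" by blast
next
  fix P :: "(real ^ 'a) \<times> (real ^ 'b) \<Rightarrow> real" assume "P \<in> ?R"
  then obtain c where P: "P = (\<lambda>p. \<Sum>i\<in>multi_indices n.
      c i * (vmonom (fst i) (fst p) * vmonom (snd i) (snd p)))"
    by blast
  have "P = (\<lambda>(x, y). \<Sum>(\<alpha>, \<beta>)\<in>multi_indices n.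
      (\<lambda>\<alpha> \<beta>. c (\<alpha>, \<beta>)) \<alpha> \<beta> * (\<Prod>i\<in>UNIV. (x $ i) ^ \<alpha> i) * (\<Prod>j\<in>UNIV. (y $ j) ^ \<beta> j))"
    unfolding P by (auto simp: fun_eq_iff case_prod_beta vmonom_def mult_ac)
  then show "P \<in> polynomials n"
    unfolding polynomials_def by (intro CollectI exI[of _ "\<lambda>\<alpha> \<beta>. c (\<alpha>, \<beta>)"])
qed

lemma polynomials_monom:
  assumes "sum \<alpha> UNIV + sum \<beta> UNIV \<le> n"
  shows "(\<lambda>p. vmonom \<alpha> (fst p) * vmonom \<beta> (snd p)) \<in> polynomials n"
proof -
  have "(\<Sum>i\<in>multi_indices n. (if i = (\<alpha>, \<beta>) then 1 else 0) *
      (vmonom (fst i) (fst p) * vmonom (snd i) (snd p))) = vmonom \<alpha> (fst p) * vmonom \<beta> (snd p)"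
    for p :: "(real ^ 'a) \<times> (real ^ 'b)"
    using assms by (subst sum.remove[OF finite_multi_indices, of "(\<alpha>, \<beta>)"])
      (auto simp: multi_indices_def)
  then show ?thesis
    unfolding polynomials_eq
    by (intro CollectI exI[of _ "\<lambda>i. if i = (\<alpha>, \<beta>) then 1 else 0"]) (simp add: fun_eq_iff)
qed

lemma polynomials_add:
  "P \<in> polynomials n \<Longrightarrow> Q \<in> polynomials n \<Longrightarrow> (\<lambda>p. P p + Q p) \<in> polynomials n"
  unfolding polynomials_eq
proof clarify
  fix c d :: "('a \<Rightarrow> nat) \<times> ('b \<Rightarrow> nat) \<Rightarrow> real"
  show "\<exists>e. (\<lambda>p. (\<Sum>i\<in>multi_indices n. c i * (vmonom (fst i) (fst p) * vmonom (snd i) (snd p))) +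
        (\<Sum>i\<in>multi_indices n. d i * (vmonom (fst i) (fst p) * vmonom (snd i) (snd p)))) =
      (\<lambda>p. \<Sum>i\<in>multi_indices n. e i * (vmonom (fst i) (fst p) * vmonom (snd i) (snd p)))"
    by (intro exI[of _ "\<lambda>i. c i + d i"]) (simp add: distrib_right sum.distrib)
qed

lemma polynomials_scale:
  assumes "P \<in> polynomials n"
  shows "(\<lambda>p. k * P p) \<in> polynomials n"
proof -
  obtain c where "P = (\<lambda>p. \<Sum>i\<in>multi_indices n.
      c i * (vmonom (fst i) (fst p) * vmonom (snd i) (snd p)))"
    using assms unfolding polynomials_eq by blast
  then have "(\<lambda>p. k * P p) = (\<lambda>p. \<Sum>i\<in>multi_indices n.
      (k * c i) * (vmonom (fst i) (fst p) * vmonom (snd i) (snd p)))"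
    by (simp add: sum_distrib_left mult.assoc)
  then show ?thesis unfolding polynomials_eq by (intro CollectI exI[of _ "\<lambda>i. k * c i"])
qed

lemma polynomials_const: "(\<lambda>p. k) \<in> polynomials n"
  using polynomials_scale[OF polynomials_monom[of "\<lambda>_. 0" "\<lambda>_. 0" n], of k] by simp

lemma polynomials_sum:
  assumes "\<And>i. i \<in> I \<Longrightarrow> F i \<in> polynomials n"
  shows "(\<lambda>p. \<Sum>i\<in>I. F i p) \<in> polynomials n"
  using assms
  by (induction I rule: infinite_finite_induct) (simp_all add: polynomials_const polynomials_add)

lemma polynomials_mult:
  assumes "P \<in> polynomials m" "Q \<in> polynomials n"
  shows "(\<lambda>p. P p * Q p) \<in> polynomials (m + n)"
proof -
  obtain c d where P: "P = (\<lambda>p. \<Sum>i\<in>multi_indices m.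
      c i * (vmonom (fst i) (fst p) * vmonom (snd i) (snd p)))"
    and Q: "Q = (\<lambda>p. \<Sum>i\<in>multi_indices n.
      d i * (vmonom (fst i) (fst p) * vmonom (snd i) (snd p)))"
    using assms unfolding polynomials_eq by blast
  have "(\<lambda>p. \<Sum>i\<in>multi_indices m. \<Sum>j\<in>multi_indices n. c i * d j *
      (vmonom (\<lambda>k. fst i k + fst j k) (fst p) * vmonom (\<lambda>k. snd i k + snd j k) (snd p)))
      \<in> polynomials (m + n)"
    by (intro polynomials_sum polynomials_scale polynomials_monom)
      (auto simp: multi_indices_def sum.distrib)
  then show ?thesis
    unfolding P Q by (simp add: sum_product vmonom_add mult_ac)
qed

lemma polynomials_power:
  assumes "P \<in> polynomials 1"
  shows "(\<lambda>p. P p ^ k) \<in> polynomials k"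
proof (induction k)
  case 0
  show ?case by (simp add: polynomials_const)
next
  case (Suc k)
  from polynomials_mult[OF assms Suc.IH] show ?case by simp
qed

lemma polynomials_prod:
  assumes "finite I" "\<And>i. i \<in> I \<Longrightarrow> F i \<in> polynomials (d i)"
  shows "(\<lambda>p. \<Prod>i\<in>I. F i p) \<in> polynomials (sum d I)"
  using assms
  by (induction I rule: finite_induct) (simp_all add: polynomials_const polynomials_mult)

lemma polynomials_mono:
  assumes "P \<in> polynomials m" "m \<le> n"
  shows "P \<in> polynomials n"
  using polynomials_mult[OF assms(1) polynomials_const[of 1 "n - m"]] assms(2) by simp

lemma vmonom_axis: "vmonom (\<lambda>j. if j = i then 1 else 0) x = x $ i"
  by (subst vmonom_split[of _ _ i]) simp

lemma polynomials_fst_nth: "(\<lambda>p. fst p $ i) \<in> polynomials 1"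
  using polynomials_monom[of "\<lambda>j. if j = i then 1 else 0" "\<lambda>_. 0" 1] by (simp add: vmonom_axis)

lemma polynomials_snd_nth: "(\<lambda>p. snd p $ i) \<in> polynomials 1"
  using polynomials_monom[of "\<lambda>_. 0" "\<lambda>j. if j = i then 1 else 0" 1] by (simp add: vmonom_axis)

text \<open>
  For the change of basis to adapted monomials and back, whose coordinates have degree one.
\<close>

lemma polynomials_subst_snd:
  fixes P :: "(real ^ 'a) \<times> (real ^ 'b) \<Rightarrow> real"
  assumes P: "P \<in> polynomials n"
    and B: "\<And>j. (\<lambda>p :: (real ^ 'a) \<times> (real ^ 'b). B (snd p) $ j) \<in> polynomials 1"
  shows "(\<lambda>p. P (fst p, B (snd p))) \<in> polynomials n"
proof -
  obtain c where P: "P = (\<lambda>p. \<Sum>i\<in>multi_indices n.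
      c i * (vmonom (fst i) (fst p) * vmonom (snd i) (snd p)))"
    using assms unfolding polynomials_eq by blast
  have "(\<lambda>p :: (real ^ 'a) \<times> (real ^ 'b). (\<Prod>j\<in>UNIV. (fst p $ j) ^ fst i j) * (\<Prod>j\<in>UNIV. (B (snd p) $ j) ^ snd i j))
      \<in> polynomials n" if "i \<in> multi_indices n" for i
  proof (rule polynomials_mono)
    show "(\<lambda>p :: (real ^ 'a) \<times> (real ^ 'b). (\<Prod>j\<in>UNIV. (fst p $ j) ^ fst i j) * (\<Prod>j\<in>UNIV. (B (snd p) $ j) ^ snd i j))
      \<in> polynomials (sum (fst i) UNIV + sum (snd i) UNIV)"
      by (intro polynomials_mult polynomials_prod polynomials_power polynomials_fst_nth B) simp_all
  qed (use that in \<open>auto simp: multi_indices_def\<close>)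
  then show ?thesis
    unfolding P vmonom_def fst_conv snd_conv
    by (intro polynomials_sum polynomials_scale)
qed

lemma continuous_on_polynomial:
  assumes "P \<in> polynomials n"
  shows "continuous_on S P"
proof -
  obtain c where P: "P = (\<lambda>p. \<Sum>i\<in>multi_indices n.
      c i * (vmonom (fst i) (fst p) * vmonom (snd i) (snd p)))"
    using assms unfolding polynomials_eq by blast
  show ?thesis unfolding P by (intro continuous_intros)
qed

section \<open>Coordinates adapted to the surface\<close>

text \<open>
  On the surface the coordinate \<open>|y|\<close> that replaces \<open>y\<^sub>l\<close> equals \<open>\<parallel>x\<parallel>\<close>; this separates the variables both in
  the weight and in the operator.
\<close>

definition adapt :: "'b::finite \<Rightarrow> real ^ 'b \<Rightarrow> real ^ 'b"
  where "adapt l y = (\<chi> j. if j = l then coord_sum y else y $ j)"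

definition unadapt :: "'b::finite \<Rightarrow> real ^ 'b \<Rightarrow> real ^ 'b"
  where "unadapt l z = (\<chi> j. if j = l then z $ l - (\<Sum>i\<in>UNIV - {l}. z $ i) else z $ j)"

lemma adapt_nth [simp]: "adapt l y $ l = coord_sum y" "j \<noteq> l \<Longrightarrow> adapt l y $ j = y $ j"
  by (simp_all add: adapt_def)

lemma coord_sum_remove: "coord_sum y = y $ l + (\<Sum>i\<in>UNIV - {l}. y $ i)"
  unfolding coord_sum_def by (rule sum.remove) auto

lemma unadapt_adapt [simp]: "unadapt l (adapt l y) = y"
  by (simp add: unadapt_def adapt_def vec_eq_iff coord_sum_remove[of y l])

definition amonom :: "'b \<Rightarrow> ('a \<Rightarrow> nat) \<times> ('b \<Rightarrow> nat) \<Rightarrow> (real ^ 'a::finite) \<times> (real ^ 'b::finite) \<Rightarrow> real"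
  where "amonom l i p = vmonom (fst i) (fst p) * vmonom (snd i) (adapt l (snd p))"

lemma polynomials_amonom:
  fixes i :: "('a::finite \<Rightarrow> nat) \<times> ('b::finite \<Rightarrow> nat)"
  assumes "sum (fst i) UNIV + sum (snd i) UNIV \<le> n"
  shows "amonom l i \<in> polynomials n"
proof -
  have "(\<lambda>p :: (real ^ 'a) \<times> (real ^ 'b). adapt l (snd p) $ j) \<in> polynomials 1" for j
  proof (cases "j = l")
    case True
    have "(\<lambda>p :: (real ^ 'a) \<times> (real ^ 'b). \<Sum>i\<in>UNIV. snd p $ i) \<in> polynomials 1"
      by (intro polynomials_sum polynomials_snd_nth)
    with True show ?thesis by (simp add: coord_sum_def)
  next
    case False
    then show ?thesis by (simp add: polynomials_snd_nth[simplified])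
  qed
  from polynomials_subst_snd[OF polynomials_monom[OF assms] this] show ?thesis
    by (simp add: amonom_def[abs_def])
qed

lemma polynomial_amonom_expansion:
  fixes P :: "(real ^ 'a) \<times> (real ^ 'b) \<Rightarrow> real"
  assumes "P \<in> polynomials n"
  obtains c where "P = (\<lambda>p. \<Sum>i\<in>multi_indices n. c i * amonom l i p)"
proof -
  have "(\<lambda>p :: (real ^ 'a) \<times> (real ^ 'b). unadapt l (snd p) $ j) \<in> polynomials 1" for j
  proof (cases "j = l")
    case True
    have "(\<lambda>p. snd p $ l + (-1) * (\<Sum>i\<in>UNIV - {l}. snd p $ i)) \<in> polynomials 1"
      by (intro polynomials_add polynomials_scale polynomials_sum polynomials_snd_nth)
    with True show ?thesis by (simp add: unadapt_def)
  next
    case False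
    then show ?thesis by (simp add: unadapt_def polynomials_snd_nth[simplified])
  qed
  from polynomials_subst_snd[OF assms this] obtain c where
    c: "(\<lambda>p. P (fst p, unadapt l (snd p))) = (\<lambda>p. \<Sum>i\<in>multi_indices n.
      c i * (vmonom (fst i) (fst p) * vmonom (snd i) (snd p)))"
    unfolding polynomials_eq by blast
  have "P p = (\<Sum>i\<in>multi_indices n. c i * amonom l i p)" for p
    using fun_cong[OF c, of "(fst p, adapt l (snd p))"] by (simp add: amonom_def)
  then show ?thesis by (intro that[of c]) (simp add: fun_eq_iff)
qed

section \<open>Integration by parts on Euclidean space\<close>

lemma lborel_translate:
  fixes g :: "'e::euclidean_space \<Rightarrow> real"
  assumes "g \<in> borel_measurable borel"
  shows "integral\<^sup>L lborel (\<lambda>x. g (x + c)) = integral\<^sup>L lborel g"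
    and "integrable lborel (\<lambda>x. g (x + c)) \<longleftrightarrow> integrable lborel g"
proof -
  have m: "(+) c \<in> measurable lborel (borel :: 'e measure)" by simp
  show "integral\<^sup>L lborel (\<lambda>x. g (x + c)) = integral\<^sup>L lborel g"
    using integral_distr[OF m assms] by (simp add: lborel_distr_plus add.commute)
  show "integrable lborel (\<lambda>x. g (x + c)) \<longleftrightarrow> integrable lborel g"
    using integrable_distr_eq[OF m assms] by (simp add: lborel_distr_plus add.commute)
qed

text \<open>
  By translation invariance \<open>h (x + e) - h x\<close> integrates to \<open>0\<close>.  On almost every line it equals the
  integral of \<open>g (x + s e)\<close> over \<open>0 \<le> s \<le> 1\<close>, and exchanging the two integrals turns it into the
  integral of \<open>g\<close>.  The exceptional null set of lines leaves room for a singularity of \<open>h\<close> at the origin.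
\<close>

lemma integral_directional_derivative_eq_0:
  fixes h g :: "'e::euclidean_space \<Rightarrow> real"
  assumes h: "integrable lborel h" and g: "integrable lborel g"
    and der: "AE x in lborel. \<forall>s. ((\<lambda>s. h (x + s *\<^sub>R e)) has_real_derivative g (x + s *\<^sub>R e)) (at s)"
  shows "integral\<^sup>L lborel g = 0"
proof -
  have [measurable]: "g \<in> borel_measurable borel" "h \<in> borel_measurable borel"
    using g h by (auto dest: borel_measurable_integrable)
  have trans: "integral\<^sup>L lborel (\<lambda>x. k (x + c)) = integral\<^sup>L lborel k"
    if "k \<in> borel_measurable borel" for k :: "'e \<Rightarrow> real" and c
    by (rule lborel_translate(1)[OF that])
  define G where "G = (\<lambda>p::real \<times> 'e. indicator {0..1} (fst p) * g (snd p + fst p *\<^sub>R e))"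
  have Gm: "G \<in> borel_measurable (lborel \<Otimes>\<^sub>M lborel)"
    unfolding G_def by measurable
  have G: "integrable (lborel \<Otimes>\<^sub>M lborel) G"
  proof (rule lborel_pair.Fubini_integrable[OF Gm])
    have "(\<integral>y. norm (G (s, y)) \<partial>lborel) = indicator {0..1} s * (\<integral>y. \<bar>g y\<bar> \<partial>lborel)" for s
      using trans[of "\<lambda>x. \<bar>g x\<bar>" "s *\<^sub>R e"] by (simp add: G_def abs_mult)
    then show "integrable lborel (\<lambda>s. \<integral>y. norm (G (s, y)) \<partial>lborel)"
      by (simp add: integrable_indicator_iff)
    show "AE s in lborel. integrable lborel (\<lambda>y. G (s, y))"
      using lborel_translate(2)[of g] g by (simp add: G_def)
  qed
  \<comment> \<open>the fundamental theorem of calculus on the segment from \<open>x\<close> to \<open>x + e\<close>\<close>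
  have "AE x in lborel. (\<integral>s. G (s, x) \<partial>lborel) = h (x + e) - h x"
    using der lborel_pair.AE_integrable_fst'[OF lborel_pair.integrable_product_swap[OF G]]
  proof eventually_elim
    case (elim x)
    have "set_integrable lborel {0..1} (\<lambda>s. g (x + s *\<^sub>R e))"
      using elim(2) by (simp add: G_def set_integrable_def)
    then have "(LINT s:{0..1}|lborel. g (x + s *\<^sub>R e)) = integral {0..1} (\<lambda>s. g (x + s *\<^sub>R e))"
      by (rule set_borel_integral_eq_integral)
    moreover have "((\<lambda>s. g (x + s *\<^sub>R e)) has_integral h (x + 1 *\<^sub>R e) - h (x + 0 *\<^sub>R e)) {0..1}"
      using elim(1)
      by (intro fundamental_theorem_of_calculus)
        (auto simp flip: has_real_derivative_iff_has_vector_derivative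
          intro: has_field_derivative_at_within)
    ultimately show ?case
      by (simp add: integral_unique G_def set_lebesgue_integral_def)
  qed
  then have "(\<integral>x. \<integral>s. G (s, x) \<partial>lborel \<partial>lborel) = (\<integral>x. h (x + e) - h x \<partial>lborel)"
  proof (rule integral_cong_AE[rotated 2])
    have "(\<lambda>(x, s). G (s, x)) \<in> borel_measurable (lborel \<Otimes>\<^sub>M lborel)"
      unfolding G_def by measurable
    then show "(\<lambda>x. \<integral>s. G (s, x) \<partial>lborel) \<in> borel_measurable lborel"
      using lborel.borel_measurable_lebesgue_integral
        [of "\<lambda>x s. G (s, x)"] by simp
  qed simp
  also have "\<dots> = 0"
    using trans[of h e] h lborel_translate(2)[of h e] by simp
  finally have "(\<integral>s. \<integral>x. G (s, x) \<partial>lborel \<partial>lborel) = 0"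
    using lborel_pair.Fubini_integral[of "\<lambda>s x. G (s, x)"] G by simp
  moreover have "(\<integral>x. G (s, x) \<partial>lborel) = indicator {0..1} s * integral\<^sup>L lborel g" for s
    using trans[of g "s *\<^sub>R e"] by (simp add: G_def)
  ultimately show ?thesis by simp
qed

section \<open>Integrability of monomials against a radial weight\<close>

lemma has_bochner_integral_Gamma:
  assumes "p > (0 :: real)"
  shows "has_bochner_integral lborel (\<lambda>t. indicator {0..} t * t powr (p - 1) / exp t) (Gamma p)"
proof (rule has_bochner_integral_nn_integral)
  show "(\<integral>\<^sup>+ t. ennreal (indicator {0..} t * t powr (p - 1) / exp t) \<partial>lborel) = ennreal (Gamma p)"
    using Gamma_conv_nn_integral_real[OF assms] by simp
  show "0 \<le> Gamma p"
    using Gamma_real_pos[OF assms] by simp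
qed simp_all

lemma integrable_two_sided_Gamma:
  fixes p c :: real
  assumes p: "p > 0" and c: "c > 0"
  shows "integrable lborel (\<lambda>t. \<bar>c * t\<bar> powr (p - 1) * exp (- \<bar>c * t\<bar>))"
proof -
  let ?f = "\<lambda>t::real. indicator {0..} t * t powr (p - 1) / exp t"
  have f: "integrable lborel ?f"
    using has_bochner_integral_Gamma[OF p] by (auto simp: has_bochner_integral_iff)
  have "integrable lborel (\<lambda>t. ?f (0 + c * t) + ?f (0 + (- c) * t))"
    using c by (intro Bochner_Integration.integrable_add lborel_integrable_real_affine[OF f]) auto
  moreover have "?f (0 + c * t) + ?f (0 + (- c) * t) = \<bar>c * t\<bar> powr (p - 1) * exp (- \<bar>c * t\<bar>)" for t
    using c by (cases t "0::real" rule: linorder_cases)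
      (auto simp: indicator_def exp_minus field_simps zero_le_mult_iff mult_le_0_iff abs_mult)
  ultimately show ?thesis by simp
qed

lemma integrable_lborel_prod:
  fixes f :: "real \<Rightarrow> real"
  assumes f: "integrable lborel f" and nn: "\<And>t. 0 \<le> f t"
  shows "integrable lborel (\<lambda>x :: real ^ 'k. \<Prod>i\<in>UNIV. f (x $ i))"
proof -
  have [measurable]: "f \<in> borel_measurable borel"
    using f by (auto dest: borel_measurable_integrable)
  have eq: "(\<Prod>i\<in>UNIV. f (x $ i)) = (\<Prod>b\<in>Basis. f (x \<bullet> b))" for x :: "real ^ 'k"
  proof -
    have B: "(Basis :: (real ^ 'k) set) = (\<lambda>i. axis i 1) ` UNIV"
      by (auto simp: Basis_vec_def)
    have "inj (\<lambda>i :: 'k. axis i (1::real))"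
      by (simp add: inj_on_def axis_eq_axis)
    then have "(\<Prod>b\<in>Basis. f (x \<bullet> b)) = (\<Prod>i\<in>UNIV. f (x \<bullet> axis i 1))"
      by (subst B) (simp add: prod.reindex)
    then show ?thesis by (simp add: inner_axis)
  qed
  have "(\<integral>\<^sup>+ x. ennreal (\<Prod>b\<in>Basis. f (x \<bullet> b)) \<partial>(lborel :: (real ^ 'k) measure)) =
      (\<integral>\<^sup>+ x. (\<Prod>b\<in>Basis. ennreal (f (x \<bullet> b))) \<partial>(lborel :: (real ^ 'k) measure))"
    using nn by (simp add: prod_ennreal)
  also have "\<dots> = (\<Prod>b\<in>(Basis :: (real ^ 'k) set). \<integral>\<^sup>+ t. ennreal (f t) \<partial>lborel)"
    by (subst nn_integral_lborel_prod) simp_all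
  also have "\<dots> < \<infinity>"
    using f nn by (simp add: nn_integral_eq_integral ennreal_prod_eq_top power_less_top_ennreal)
  finally show ?thesis
    unfolding eq using nn by (intro integrableI_nonneg) (auto intro: prod_nonneg)
qed

text \<open>
  Integer exponents of \<open>\<parallel>x\<parallel>\<close> make this family closed under partial derivatives away from the origin
  (\<open>kern_line\<close>).  It contains the moment integrands as well as the homogeneous extensions
  \<open>x\<^sup>\<alpha> \<parallel>x\<parallel>\<^bsup>-|\<alpha>|\<^esup>\<close> that define the Laplace--Beltrami operator.
\<close>

definition kern :: "('k::finite \<Rightarrow> nat) \<Rightarrow> int \<Rightarrow> real ^ 'k \<Rightarrow> real"
  where "kern \<alpha> s x = vmonom \<alpha> x * norm x powi s"

lemma AE_nth_neq_0: "AE x :: real ^ 'k in lborel. x $ i \<noteq> 0"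
  using AE_lborel_inner_neq[of "axis i 1 :: real ^ 'k" 0] by (simp add: inner_axis axis_in_Basis_iff)

lemma abs_vmonom_le: "\<bar>vmonom \<alpha> x\<bar> \<le> norm x ^ sum \<alpha> UNIV"
proof -
  have "\<bar>vmonom \<alpha> x\<bar> = (\<Prod>i\<in>UNIV. \<bar>x $ i\<bar> ^ \<alpha> i)"
    by (simp add: vmonom_def abs_prod power_abs)
  also have "\<dots> \<le> (\<Prod>i\<in>UNIV. norm x ^ \<alpha> i)"
    by (intro prod_mono conjI power_mono component_le_norm_cart) auto
  finally show ?thesis by (simp add: power_sum)
qed

lemma power_le_fact_exp:
  fixes r :: real
  assumes "r \<ge> 0"
  shows "r ^ m \<le> fact m * exp r"
proof -
  have "(\<Sum>k\<in>{m}. r ^ k /\<^sub>R fact k) \<le> (\<Sum>k. r ^ k /\<^sub>R fact k)"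
    using assms by (intro sum_le_suminf) (auto simp: summable_exp)
  then show ?thesis
    by (simp add: exp_def field_simps)
qed

text \<open>
  The singularity \<open>1 / \<parallel>x\<parallel>\<close> is dominated by a product of functions of one variable: \<open>\<parallel>x\<parallel>\<close> is at least
  each \<open>|x\<^sub>i|\<close>, hence at least their geometric mean, and at least their arithmetic mean.  For \<open>d \<ge> 2\<close> the
  exponent \<open>-1/d\<close> is integrable on the line.
\<close>

lemma radial_bound:
  fixes x :: "real ^ 'a"
  assumes nz: "\<And>i. x $ i \<noteq> 0"
  defines "d \<equiv> real CARD('a)"
  defines "c \<equiv> 1 / (2 * d)"
  shows "exp (- norm x / 2) / norm x
    \<le> c * (\<Prod>i\<in>UNIV. \<bar>c * x $ i\<bar> powr (- (1 / d)) * exp (- \<bar>c * x $ i\<bar>))"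
proof -
  have d: "d > 0" and c: "c > 0" by (simp_all add: d_def c_def)
  have x: "norm x > 0" using nz by auto
  have "(c * norm x) powr (- (1 / d)) \<le> \<bar>c * x $ i\<bar> powr (- (1 / d))" for i
    using nz[of i] c d component_le_norm_cart[of x i]
    by (intro powr_mono2') (auto simp: abs_mult)
  then have "(\<Prod>i\<in>(UNIV :: 'a set). (c * norm x) powr (- (1 / d)))
      \<le> (\<Prod>i\<in>UNIV. \<bar>c * x $ i\<bar> powr (- (1 / d)))"
    by (intro prod_mono) auto
  moreover have "(\<Prod>i\<in>(UNIV :: 'a set). (c * norm x) powr (- (1 / d))) = 1 / (c * norm x)"
    using c x d powr_power[of "c * norm x" "- (1 / d)" "CARD('a)"]
    by (simp add: d_def powr_minus_divide del: powr_power)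
  ultimately have 1: "1 / (c * norm x) \<le> (\<Prod>i\<in>UNIV. \<bar>c * x $ i\<bar> powr (- (1 / d)))" by simp
  have "(\<Sum>i\<in>UNIV. \<bar>c * x $ i\<bar>) \<le> (\<Sum>i\<in>(UNIV :: 'a set). c * norm x)"
    using c component_le_norm_cart[of x] by (intro sum_mono) (auto simp: abs_mult)
  also have "\<dots> = norm x / 2"
    using d by (simp add: c_def d_def)
  finally have 2: "exp (- norm x / 2) \<le> (\<Prod>i\<in>UNIV. exp (- \<bar>c * x $ i\<bar>))"
    by (simp add: sum_negf flip: exp_sum)
  have "exp (- norm x / 2) / norm x = c * (1 / (c * norm x) * exp (- norm x / 2))"
    using c by simp
  also have "\<dots> \<le> c * ((\<Prod>i\<in>UNIV. \<bar>c * x $ i\<bar> powr (- (1 / d))) * (\<Prod>i\<in>UNIV. exp (- \<bar>c * x $ i\<bar>)))"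
    using c x by (intro mult_left_mono mult_mono 1 2) (auto intro: prod_nonneg)
  finally show ?thesis by (simp add: prod.distrib)
qed

lemma kern_measurable [measurable]: "kern \<alpha> s \<in> borel_measurable borel"
proof -
  have [measurable]: "vmonom \<alpha> \<in> borel_measurable borel"
    using continuous_on_vmonom[of UNIV "\<lambda>x. x" \<alpha>] by (intro borel_measurable_continuous_onI) simp
  show ?thesis
    unfolding kern_def[abs_def] power_int_def by measurable
qed

text \<open>
  Near the origin the integrand is bounded by \<open>\<parallel>x\<parallel>\<^bsup>|\<alpha>| + s\<^esup>\<close>.  The degree \<open>-1\<close> occurs for the density
  \<open>e\<^bsup>-\<parallel>x\<parallel>\<^esup> / \<parallel>x\<parallel>\<close> itself and for the first derivatives of functions of degree \<open>0\<close>.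
\<close>

lemma integrable_kern:
  fixes \<alpha> :: "'a::finite \<Rightarrow> nat"
  assumes dim: "CARD('a) \<ge> 2" and s: "int (sum \<alpha> UNIV) + s \<ge> -1"
  shows "integrable lborel (\<lambda>x. kern \<alpha> s x * exp (- norm x))"
proof -
  define d where "d = real CARD('a)"
  define c where "c = 1 / (2 * d)"
  define m where "m = nat (int (sum \<alpha> UNIV) + s + 1)"
  define C where "C = fact m * 2 ^ m * c"
  let ?F = "\<lambda>t. \<bar>c * t\<bar> powr (- (1 / d)) * exp (- \<bar>c * t\<bar>)"
  have "c > 0" "1 - 1 / d > 0" using dim by (simp_all add: c_def d_def)
  from integrable_two_sided_Gamma[OF this(2,1)] have "integrable lborel ?F" by simp
  from integrable_lborel_prod[OF this]
  have "integrable lborel (\<lambda>x :: real ^ 'a. C * (\<Prod>i\<in>UNIV. ?F (x $ i)))"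
    by (intro integrable_mult_right) auto
  then show ?thesis
  proof (rule Bochner_Integration.integrable_bound)
    have "AE x :: real ^ 'a in lborel. \<forall>i\<in>UNIV. x $ i \<noteq> 0"
      by (intro AE_finite_allI AE_nth_neq_0) auto
    then show "AE x :: real ^ 'a in lborel.
        norm (kern \<alpha> s x * exp (- norm x)) \<le> norm (C * (\<Prod>i\<in>UNIV. ?F (x $ i)))"
    proof eventually_elim
      case (elim x)
      then have x: "norm x > 0" by auto
      have "norm (kern \<alpha> s x * exp (- norm x)) \<le> norm x ^ sum \<alpha> UNIV * norm x powi s * exp (- norm x)"
        unfolding kern_def real_norm_def abs_mult
        using x abs_vmonom_le[of \<alpha> x] by (intro mult_mono) auto
      also have "norm x ^ sum \<alpha> UNIV * norm x powi s = norm x powi (int m - 1)"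
      proof -
        have m: "int m - 1 = int (sum \<alpha> UNIV) + s"
          using s unfolding m_def by linarith
        show ?thesis
          unfolding m using x power_int_add[of "norm x" "int (sum \<alpha> UNIV)" s]
          by (simp del: of_nat_sum)
      qed
      also have "\<dots> = norm x ^ m / norm x"
        using x by (simp add: power_int_diff)
      \<comment> \<open>half of the exponential absorbs the power \<open>m\<close>, the other half stays for \<open>radial_bound\<close>\<close>
      also have "norm x ^ m / norm x * exp (- norm x) =
          (2 ^ m * (norm x / 2) ^ m) * (exp (- norm x / 2) * (exp (- norm x / 2) / norm x))"
        using x by (simp add: power_divide flip: exp_add)
      also have "\<dots> \<le> (2 ^ m * (fact m * exp (norm x / 2))) * (exp (- norm x / 2) * (exp (- norm x / 2) / norm x))"
        using x by (intro mult_right_mono mult_left_mono power_le_fact_exp) auto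
      also have "\<dots> = 2 ^ m * fact m * (exp (- norm x / 2) / norm x)"
        by (simp add: exp_minus field_simps)
      also have "\<dots> \<le> 2 ^ m * fact m * (c * (\<Prod>i\<in>UNIV. ?F (x $ i)))"
        unfolding c_def d_def using elim by (intro mult_left_mono radial_bound) auto
      also have "\<dots> = C * (\<Prod>i\<in>UNIV. ?F (x $ i))" by (simp add: C_def mult_ac)
      finally show ?case by simp
    qed
  qed measurable
qed

lemma vmonom_line:
  "((\<lambda>t. vmonom \<alpha> (x + t *\<^sub>R axis i 1)) has_real_derivative
    real (\<alpha> i) * vmonom (\<alpha>(i := \<alpha> i - 1)) (x + t *\<^sub>R axis i 1)) (at t)"
proof -
  have eq: "vmonom (\<alpha>(i := k)) (x + t *\<^sub>R axis i 1) = (x $ i + t) ^ k * (\<Prod>j\<in>UNIV - {i}. (x $ j) ^ \<alpha> j)" for k t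
    unfolding vmonom_upd by (auto intro!: prod.cong simp: axis_def)
  have "vmonom \<alpha> (x + t *\<^sub>R axis i 1) = (x $ i + t) ^ \<alpha> i * (\<Prod>j\<in>UNIV - {i}. (x $ j) ^ \<alpha> j)" for t
    using eq[of "\<alpha> i" t] by simp
  then show ?thesis
    unfolding eq by (auto intro!: derivative_eq_intros)
qed

lemma norm_line:
  fixes x :: "real ^ 'k"
  assumes "x + t *\<^sub>R axis i 1 \<noteq> 0"
  shows "((\<lambda>t. norm (x + t *\<^sub>R axis i 1)) has_real_derivative
    (x + t *\<^sub>R axis i 1) $ i / norm (x + t *\<^sub>R axis i 1)) (at t)"
proof -
  have "((\<lambda>t. norm (x + t *\<^sub>R axis i 1)) has_derivative
      (\<lambda>h. inner (h *\<^sub>R axis i 1) (sgn (x + t *\<^sub>R axis i 1)))) (at t)"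
    by (rule has_derivative_compose[of "\<lambda>t. x + t *\<^sub>R axis i 1", OF _ has_derivative_norm[OF assms]])
      (auto intro!: derivative_eq_intros)
  moreover have "(\<lambda>h. inner (h *\<^sub>R axis i 1) (sgn (x + t *\<^sub>R axis i 1))) =
      (*) ((x + t *\<^sub>R axis i 1) $ i / norm (x + t *\<^sub>R axis i 1))"
    by (simp add: fun_eq_iff inner_axis' sgn_div_norm divide_inverse mult_ac)
  ultimately show ?thesis
    by (simp add: has_field_derivative_def)
qed

lemma kern_line:
  fixes x :: "real ^ 'k"
  assumes "x + t *\<^sub>R axis i 1 \<noteq> 0"
  shows "((\<lambda>t. kern \<alpha> s (x + t *\<^sub>R axis i 1)) has_real_derivative
    real (\<alpha> i) * kern (\<alpha>(i := \<alpha> i - 1)) s (x + t *\<^sub>R axis i 1)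
    + of_int s * kern (\<alpha>(i := \<alpha> i + 1)) (s - 2) (x + t *\<^sub>R axis i 1)) (at t)"
proof -
  define z where "z = x + t *\<^sub>R axis i 1"
  have z: "norm z > 0" using assms by (simp add: z_def)
  have "vmonom (\<alpha>(i := \<alpha> i + 1)) z = z $ i * vmonom \<alpha> z"
    by (simp add: vmonom_upd vmonom_split[of \<alpha> z i])
  moreover have "norm z powi (s - 2) = norm z powi (s - 1) / norm z"
    using z power_int_diff[of "norm z" "s - 1" 1] by simp
  ultimately have eq: "vmonom \<alpha> z * (of_int s * norm z powi (s - 1) * (z $ i / norm z)) =
      of_int s * kern (\<alpha>(i := \<alpha> i + 1)) (s - 2) z"
    by (simp add: kern_def)
  have "((\<lambda>t. kern \<alpha> s (x + t *\<^sub>R axis i 1)) has_real_derivative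
      (real (\<alpha> i) * vmonom (\<alpha>(i := \<alpha> i - 1)) z) * norm z powi s
      + vmonom \<alpha> z * (of_int s * norm z powi (s - 1) * (z $ i / norm z))) (at t)"
    unfolding kern_def z_def using assms
    by (auto intro!: derivative_eq_intros vmonom_line norm_line)
  then show ?thesis
    unfolding eq by (simp add: kern_def z_def mult_ac)
qed

section \<open>Moments of the radial weight\<close>

definition radial_moment :: "('a::finite \<Rightarrow> nat) \<Rightarrow> int \<Rightarrow> real"
  where "radial_moment \<alpha> s = (\<integral>x. kern \<alpha> s x * exp (- norm x) \<partial>lborel)"

text \<open>
  In dimension at least two, almost every line parallel to a coordinate axis avoids the origin.  So the
  integral of the \<open>i\<close>-th partial derivative of \<open>x\<^sup>\<alpha> \<parallel>x\<parallel>\<^sup>s e\<^bsup>-\<parallel>x\<parallel>\<^esup>\<close> vanishes; the three terms are those of the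
  product rule.
\<close>

lemma radial_moment_by_parts:
  fixes \<alpha> :: "'a::finite \<Rightarrow> nat"
  assumes dim: "CARD('a) \<ge> 2" and s: "int (sum \<alpha> UNIV) + s \<ge> 0"
  shows "real (\<alpha> i) * radial_moment (\<alpha>(i := \<alpha> i - 1)) s
    + of_int s * radial_moment (\<alpha>(i := \<alpha> i + 1)) (s - 2)
    = radial_moment (\<alpha>(i := \<alpha> i + 1)) (s - 1)"
proof -
  let ?K = "\<lambda>\<alpha> s x :: real ^ 'a. kern \<alpha> s x * exp (- norm x)"
  let ?g = "\<lambda>x. real (\<alpha> i) * ?K (\<alpha>(i := \<alpha> i - 1)) s x + of_int s * ?K (\<alpha>(i := \<alpha> i + 1)) (s - 2) x
      - ?K (\<alpha>(i := \<alpha> i + 1)) (s - 1) x"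
  have int: "integrable lborel (?K \<alpha> s)" "integrable lborel (?K (\<alpha>(i := \<alpha> i - 1)) s)"
      "integrable lborel (?K (\<alpha>(i := \<alpha> i + 1)) (s - 2))"
      "integrable lborel (?K (\<alpha>(i := \<alpha> i + 1)) (s - 1))"
    using s sum_upd[of \<alpha> i "\<alpha> i - 1"] sum_upd[of \<alpha> i "\<alpha> i + 1"]
    by (intro integrable_kern dim; linarith)+
  obtain j where j: "j \<noteq> i"
    using dim ex_card[of 2 "UNIV :: 'a set"] by (metis UNIV_I card_2_iff)
  have "integral\<^sup>L lborel ?g = 0"
  proof (rule integral_directional_derivative_eq_0[where h = "?K \<alpha> s" and e = "axis i 1"])
    show "AE x in lborel. \<forall>t. ((\<lambda>t. ?K \<alpha> s (x + t *\<^sub>R axis i 1)) has_real_derivative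
        ?g (x + t *\<^sub>R axis i 1)) (at t)"
      using AE_nth_neq_0[of j]
    proof eventually_elim
      case (elim x)
      show ?case
      proof
        fix t
        define z where "z = x + t *\<^sub>R axis i 1"
        have "z $ j \<noteq> 0" using elim j by (simp add: z_def axis_def)
        then have nz: "z \<noteq> 0" by auto
        have "vmonom (\<alpha>(i := \<alpha> i + 1)) z = z $ i * vmonom \<alpha> z"
          by (simp add: vmonom_upd vmonom_split[of \<alpha> z i])
        then have eq: "kern \<alpha> s z * (z $ i / norm z) = kern (\<alpha>(i := \<alpha> i + 1)) (s - 1) z"
          using nz by (simp add: kern_def power_int_diff)
        have "((\<lambda>t. ?K \<alpha> s (x + t *\<^sub>R axis i 1)) has_real_derivative
            (real (\<alpha> i) * kern (\<alpha>(i := \<alpha> i - 1)) s z + of_int s * kern (\<alpha>(i := \<alpha> i + 1)) (s - 2) z)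
              * exp (- norm z) + kern \<alpha> s z * (exp (- norm z) * - (z $ i / norm z))) (at t)"
          unfolding z_def using nz[unfolded z_def]
          by (auto intro!: derivative_eq_intros kern_line norm_line)
        moreover have "kern \<alpha> s z * (exp (- norm z) * - (z $ i / norm z)) =
            - (kern \<alpha> s z * (z $ i / norm z)) * exp (- norm z)" by simp
        ultimately show "((\<lambda>t. ?K \<alpha> s (x + t *\<^sub>R axis i 1)) has_real_derivative
            ?g (x + t *\<^sub>R axis i 1)) (at t)"
          unfolding eq z_def[symmetric] by (simp add: algebra_simps)
      qed
    qed
  qed (intro Bochner_Integration.integrable_add Bochner_Integration.integrable_diff
      integrable_mult_right int)+
  then show ?thesis
    using int by (simp add: radial_moment_def)
qed

text \<open>
  Summing the integrations by parts for \<open>x\<^sub>i x\<^sup>\<alpha> \<parallel>x\<parallel>\<^sup>s e\<^bsup>-\<parallel>x\<parallel>\<^esup>\<close> over \<open>i\<close> amounts to differentiating along the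
  radial vector field; this is the recursion of the Gamma function in the variable \<open>\<parallel>x\<parallel>\<close>.
\<close>

lemma radial_moment_Suc:
  fixes \<alpha> :: "'a::finite \<Rightarrow> nat"
  assumes dim: "CARD('a) \<ge> 2" and s: "int (sum \<alpha> UNIV) + s \<ge> -1"
  shows "radial_moment \<alpha> (s + 1) = (real (sum \<alpha> UNIV) + of_int s + real CARD('a)) * radial_moment \<alpha> s"
proof -
  have sq: "radial_moment \<alpha> r = (\<Sum>i\<in>UNIV. radial_moment (\<alpha>(i := \<alpha> i + 2)) (r - 2))"
    if r: "int (sum \<alpha> UNIV) + r \<ge> -1" for r
  proof -
    have int: "integrable lborel (\<lambda>x. kern (\<alpha>(i := \<alpha> i + 2)) (r - 2) x * exp (- norm x))" for i
      using r sum_upd[of \<alpha> i "\<alpha> i + 2"] by (intro integrable_kern dim; linarith)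
    have "radial_moment \<alpha> r =
        (\<integral>x. (\<Sum>i\<in>UNIV. kern (\<alpha>(i := \<alpha> i + 2)) (r - 2) x * exp (- norm x)) \<partial>lborel)"
      unfolding radial_moment_def
    proof (rule integral_cong_AE)
      show "AE x in lborel. kern \<alpha> r x * exp (- norm x) =
          (\<Sum>i\<in>UNIV. kern (\<alpha>(i := \<alpha> i + 2)) (r - 2) x * exp (- norm x))"
        using AE_nth_neq_0[of undefined]
      proof eventually_elim
        case (elim x)
        then have x: "norm x \<noteq> 0" by auto
        have "vmonom (\<alpha>(i := \<alpha> i + 2)) x = (x $ i)\<^sup>2 * vmonom \<alpha> x" for i
          by (simp add: vmonom_upd vmonom_split[of \<alpha> x i] power2_eq_square)
        then have "(\<Sum>i\<in>UNIV. kern (\<alpha>(i := \<alpha> i + 2)) (r - 2) x * exp (- norm x)) =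
            (\<Sum>i\<in>UNIV. (x $ i)\<^sup>2) * (vmonom \<alpha> x * norm x powi (r - 2) * exp (- norm x))"
          by (simp add: kern_def sum_distrib_left sum_distrib_right mult_ac)
        also have "(\<Sum>i\<in>UNIV. (x $ i)\<^sup>2) = norm x powi 2"
          by (simp add: norm_vec_def L2_set_def sum_nonneg)
        also have "norm x powi 2 * (vmonom \<alpha> x * norm x powi (r - 2) * exp (- norm x)) =
            vmonom \<alpha> x * (norm x powi 2 * norm x powi (r - 2)) * exp (- norm x)"
          by simp
        also have "norm x powi 2 * norm x powi (r - 2) = norm x powi r"
          using x power_int_add[of "norm x" 2 "r - 2"] by simp
        finally show ?case unfolding kern_def by (rule sym)
      qed
    qed measurable
    also have "\<dots> = (\<Sum>i\<in>UNIV. radial_moment (\<alpha>(i := \<alpha> i + 2)) (r - 2))"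
      unfolding radial_moment_def using int by (intro Bochner_Integration.integral_sum) auto
    finally show ?thesis .
  qed
  have "int (sum (\<alpha>(i := \<alpha> i + 1)) UNIV) + s \<ge> 0" for i
    using s sum_upd[of \<alpha> i "\<alpha> i + 1"] by linarith
  from radial_moment_by_parts[OF dim this]
  \<comment> \<open>integration by parts for the exponent \<open>\<alpha> + e\<^sub>i\<close>\<close>
  have parts: "real (\<alpha> i + 1) * radial_moment \<alpha> s + of_int s * radial_moment (\<alpha>(i := \<alpha> i + 2)) (s - 2)
      = radial_moment (\<alpha>(i := \<alpha> i + 2)) (s - 1)" for i
    by (metis (no_types, lifting) add_diff_cancel_right' add_2_eq_Suc' Suc_eq_plus1 fun_upd_same
        fun_upd_triv fun_upd_upd)
  have "radial_moment \<alpha> (s + 1) = (\<Sum>i\<in>UNIV. radial_moment (\<alpha>(i := \<alpha> i + 2)) (s - 1))"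
    using sq[of "s + 1"] s by simp
  also have "\<dots> = (\<Sum>i\<in>UNIV. real (\<alpha> i + 1) * radial_moment \<alpha> s
      + of_int s * radial_moment (\<alpha>(i := \<alpha> i + 2)) (s - 2))"
    using parts by simp
  also have "\<dots> = (\<Sum>i\<in>UNIV. real (\<alpha> i + 1)) * radial_moment \<alpha> s + of_int s * radial_moment \<alpha> s"
    unfolding sum.distrib sum_distrib_left[symmetric] sum_distrib_right[symmetric] sq[OF s, symmetric]
    by (rule refl)
  also have "(\<Sum>i\<in>UNIV. real (\<alpha> i + 1)) = real (sum \<alpha> UNIV) + real CARD('a)"
    by (simp add: sum.distrib)
  finally show ?thesis by (simp add: algebra_simps)
qed

section \<open>Integrals over the surface in graph coordinates\<close>

lemma integral_pair_times:
  fixes f :: "'a \<Rightarrow> real" and g :: "'b \<Rightarrow> real"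
  assumes "sigma_finite_measure M" "sigma_finite_measure N" and f: "integrable M f" and g: "integrable N g"
  shows "has_bochner_integral (M \<Otimes>\<^sub>M N) (\<lambda>p. f (fst p) * g (snd p)) (integral\<^sup>L M f * integral\<^sup>L N g)"
proof -
  interpret M: sigma_finite_measure M by fact
  interpret N: sigma_finite_measure N by fact
  interpret pair_sigma_finite M N ..
  have [measurable]: "f \<in> borel_measurable M" "g \<in> borel_measurable N"
    using f g by auto
  have int: "integrable (M \<Otimes>\<^sub>M N) (\<lambda>p. f (fst p) * g (snd p))"
    using f g by (intro Fubini_integrable) (simp_all add: abs_mult integrable_abs)
  from integral_fst'[OF this] have "integral\<^sup>L (M \<Otimes>\<^sub>M N) (\<lambda>p. f (fst p) * g (snd p)) = integral\<^sup>L M f * integral\<^sup>L N g"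
    by simp
  with int show ?thesis by (simp add: has_bochner_integral_iff)
qed

abbreviation graph_coords :: "'b::finite \<Rightarrow> ((real ^ 'a::finite) \<times> ('b \<Rightarrow> real)) measure"
  where "graph_coords l \<equiv> lborel \<Otimes>\<^sub>M (\<Pi>\<^sub>M i\<in>UNIV - {l}. lborel)"

lemma coord_sum_graph_map [simp]: "coord_sum (snd (graph_map l p)) = norm (fst p)"
  by (cases p) (simp add: graph_map_def coord_sum_remove[of _ l])

lemma graph_map_nth: "j \<noteq> l \<Longrightarrow> snd (graph_map l p) $ j = snd p j"
  by (cases p) (simp add: graph_map_def)

lemma fst_graph_map [simp]: "fst (graph_map l p) = fst p"
  by (cases p) (simp add: graph_map_def)

lemma graph_map_in_surf: "graph_map l p \<in> surf l \<longleftrightarrow> (\<forall>i. i \<noteq> l \<longrightarrow> 0 \<le> snd p i)"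
proof -
  have "graph_map l p \<in> surf l \<longleftrightarrow> (\<forall>i. i \<noteq> l \<longrightarrow> 0 \<le> snd (graph_map l p) $ i)"
    unfolding surf_def R_Sigma_def by (simp add: case_prod_beta)
  then show ?thesis by (auto simp: graph_map_nth)
qed

lemma closed_surf: "closed (surf l :: ((real ^ 'a) \<times> (real ^ 'b)) set)"
proof -
  have "surf l = (\<Inter>i\<in>UNIV - {l}. {p :: (real ^ 'a) \<times> (real ^ 'b). 0 \<le> snd p $ i})
      \<inter> {p. 0 \<le> coord_sum (snd p)} \<inter> {p. norm (fst p) = coord_sum (snd p)}"
    unfolding surf_def R_Sigma_def by auto
  also have "closed \<dots>"
    unfolding coord_sum_def
    by (intro closed_Int closed_INT ballI closed_Collect_le closed_Collect_eq continuous_intros)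
  finally show ?thesis .
qed

lemma surface_integral_graph:
  fixes f :: "(real ^ 'a) \<times> (real ^ 'b) \<Rightarrow> real"
  assumes f: "f \<in> borel_measurable borel"
    and I: "has_bochner_integral (graph_coords l)
      (\<lambda>p. indicator (surf l) (graph_map l p) * f (graph_map l p)) v"
  shows "set_integrable (surface_measure l) (surf l) f"
    and "set_lebesgue_integral (surface_measure l) (surf l) f = sqrt (1 + real CARD('b)) * v"
proof -
  let ?D = "distr (graph_coords l) borel (graph_map l) :: ((real ^ 'a) \<times> (real ^ 'b)) measure"
  let ?f = "\<lambda>p. indicator (surf l) p *\<^sub>R f p"
  have "surf l \<in> sets (borel :: ((real ^ 'a) \<times> (real ^ 'b)) measure)"
    using closed_surf by (rule borel_closed)
  with f have m: "?f \<in> borel_measurable borel" by simp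
  have D: "integrable ?D ?f" "integral\<^sup>L ?D ?f = v"
    using I integrable_distr_eq[OF measurable_graph_map m] integral_distr[OF measurable_graph_map m]
    by (simp_all add: has_bochner_integral_iff)
  have S: "surface_measure l = density ?D (\<lambda>_. ennreal (sqrt (1 + real CARD('b))))"
    unfolding surface_measure_def by (rule measure_eqI) (simp_all add: emeasure_density_const)
  show "set_integrable (surface_measure l) (surf l) f"
    "set_lebesgue_integral (surface_measure l) (surf l) f = sqrt (1 + real CARD('b)) * v"
    unfolding set_integrable_def set_lebesgue_integral_def S using m D
    by (simp_all add: integrable_density integral_density)
qed

text \<open>
  The integral of the adapted monomial with exponents \<open>(a, b)\<close> against the weight, without the constant
  factor of the surface measure (\<open>weighted_monom_integral\<close>).  The exponent \<open>b\<^sub>l - 1\<close> contains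
  \<open>|y|\<^bsup>\<kappa>\<^sub>l\<^esup> = 1 / \<parallel>x\<parallel>\<close>.
\<close>

definition moment :: "real ^ 'b \<Rightarrow> 'b \<Rightarrow> ('a::finite \<Rightarrow> nat) \<Rightarrow> ('b::finite \<Rightarrow> nat) \<Rightarrow> real"
  where "moment \<kappa> l a b = radial_moment a (int (b l) - 1) *
    (\<Prod>j\<in>UNIV - {l}. Gamma (real (b j) + \<kappa> $ j + 1))"

text \<open>
  In graph coordinates everything factors into a function of \<open>x\<close> and functions of the single coordinates
  \<open>\<eta>\<^sub>j\<close>: on the graph \<open>|y| = \<parallel>x\<parallel>\<close> is automatically nonnegative, so that the surface is described by \<open>\<eta>\<^sub>j \<ge> 0\<close>.
\<close>

lemma weighted_monom_integral:
  fixes a :: "'a::finite \<Rightarrow> nat" and b :: "'b::finite \<Rightarrow> nat"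
  assumes dim: "CARD('a) \<ge> 2" and \<kappa>: "\<And>i. i \<noteq> l \<Longrightarrow> \<kappa> $ i > -1" and \<kappa>l: "\<kappa> $ l = -1"
  shows "has_bochner_integral (graph_coords l)
    (\<lambda>p. indicator (surf l) (graph_map l p) *
      (amonom l (a, b) (graph_map l p) * weight \<kappa> l (snd (graph_map l p))))
    (moment \<kappa> l a b)"
proof -
  \<comment> \<open>off the origin this is the integrand of the radial moment; at the origin the weight is \<open>0 powr (-1) = 0\<close>,
    whereas \<open>0 powi 0 = 1\<close>, so that the pointwise factorization needs the value \<open>0\<close> there\<close>
  define F where "F = (\<lambda>x. indicator (- {0}) x * (kern a (int (b l) - 1) x * exp (- norm x)))"
  define h where "h = (\<lambda>j t. indicator {0..} t * t powr (real (b j) + \<kappa> $ j) / exp t)"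
  interpret product_sigma_finite "\<lambda>_ :: 'b. lborel :: real measure" ..
  have sf: "sigma_finite_measure (\<Pi>\<^sub>M i\<in>UNIV - {l}. (lborel :: real measure))"
    by (rule sigma_finite) simp
  have K: "integrable lborel (\<lambda>x. kern a (int (b l) - 1) x * exp (- norm x))"
    using dim by (intro integrable_kern) linarith+
  have AE: "AE x in lborel. F x = kern a (int (b l) - 1) x * exp (- norm x)"
    using AE_lborel_singleton[of 0] by eventually_elim (simp add: F_def)
  have F: "integrable lborel F" "integral\<^sup>L lborel F = radial_moment a (int (b l) - 1)"
  proof -
    have "F \<in> borel_measurable lborel"
      unfolding F_def by measurable
    with AE K show "integrable lborel F" "integral\<^sup>L lborel F = radial_moment a (int (b l) - 1)"
      unfolding radial_moment_def
      by (auto intro: integral_cong_AE simp: integrable_cong_AE[of F _ "\<lambda>x. kern a (int (b l) - 1) x * exp (- norm x)"])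
  qed
  have h: "has_bochner_integral lborel (h j) (Gamma (real (b j) + \<kappa> $ j + 1))" if "j \<in> UNIV - {l}" for j
    using has_bochner_integral_Gamma[of "real (b j) + \<kappa> $ j + 1"] \<kappa>[of j] that by (simp add: h_def[abs_def])
  have H: "integrable (\<Pi>\<^sub>M i\<in>UNIV - {l}. lborel) (\<lambda>\<eta>. \<Prod>j\<in>UNIV - {l}. h j (\<eta> j))"
    "integral\<^sup>L (\<Pi>\<^sub>M i\<in>UNIV - {l}. lborel) (\<lambda>\<eta>. \<Prod>j\<in>UNIV - {l}. h j (\<eta> j))
      = (\<Prod>j\<in>UNIV - {l}. Gamma (real (b j) + \<kappa> $ j + 1))"
    using h by (auto simp: has_bochner_integral_iff intro!: product_integrable_prod prod.cong
      product_integral_prod[THEN trans])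
  have eq: "indicator (surf l) (graph_map l p) *
      (amonom l (a, b) (graph_map l p) * weight \<kappa> l (snd (graph_map l p)))
      = F (fst p) * (\<Prod>j\<in>UNIV - {l}. h j (snd p j))" for p :: "(real ^ 'a) \<times> ('b \<Rightarrow> real)"
  proof (cases "\<forall>j. j \<noteq> l \<longrightarrow> 0 \<le> snd p j")
    case False
    then obtain j where "j \<noteq> l" "snd p j < 0" by auto
    then have "(\<Prod>j\<in>UNIV - {l}. h j (snd p j)) = 0"
      by (intro prod_zero bexI[of _ j]) (auto simp: h_def)
    with False show ?thesis by (simp add: graph_map_in_surf)
  next
    case True
    have "snd p j ^ b j * snd p j powr (\<kappa> $ j) * exp (- snd p j) = h j (snd p j)" if "j \<in> UNIV - {l}" for j
      using True that by (cases "snd p j = 0")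
        (auto simp: h_def powr_add powr_realpow exp_minus divide_inverse order_less_le)
    then have "(\<Prod>j\<in>UNIV - {l}. h j (snd p j)) =
        (\<Prod>j\<in>UNIV - {l}. snd p j ^ b j * snd p j powr (\<kappa> $ j) * exp (- snd p j))"
      by (intro prod.cong) auto
    also have "\<dots> = (\<Prod>j\<in>UNIV - {l}. snd p j ^ b j) * (\<Prod>j\<in>UNIV - {l}. snd p j powr (\<kappa> $ j))
        * exp (- (\<Sum>j\<in>UNIV - {l}. snd p j))"
      by (simp add: prod.distrib exp_sum flip: sum_negf)
    finally have h: "(\<Prod>j\<in>UNIV - {l}. h j (snd p j)) = (\<Prod>j\<in>UNIV - {l}. snd p j ^ b j) *
        (\<Prod>j\<in>UNIV - {l}. snd p j powr (\<kappa> $ j)) * exp (- (\<Sum>j\<in>UNIV - {l}. snd p j))" .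
    have F: "F (fst p) = vmonom a (fst p) * norm (fst p) ^ b l * norm (fst p) powr (-1) * exp (- norm (fst p))"
      by (cases "fst p = 0") (simp_all add: F_def kern_def power_int_diff powr_minus_divide)
    have m: "vmonom b (adapt l (snd (graph_map l p))) = norm (fst p) ^ b l * (\<Prod>j\<in>UNIV - {l}. snd p j ^ b j)"
      by (subst vmonom_split[of _ _ l]) (auto simp: graph_map_nth intro!: prod.cong)
    have w: "weight \<kappa> l (snd (graph_map l p)) = (\<Prod>j\<in>UNIV - {l}. snd p j powr (\<kappa> $ j)) *
        norm (fst p) powr (-1) * (exp (- (\<Sum>j\<in>UNIV - {l}. snd p j)) * exp (- norm (fst p)))"
      unfolding weight_def by (simp add: graph_map_nth \<kappa>l flip: exp_add)
    show ?thesis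
      using True unfolding h F w amonom_def fst_conv snd_conv m by (simp add: graph_map_in_surf mult_ac)
  qed
  show ?thesis
    unfolding eq moment_def F(2)[symmetric] H(2)[symmetric]
    by (intro integral_pair_times sf sigma_finite_lborel F H)
qed

section \<open>The operator on adapted monomials and its symmetry\<close>

text \<open>
  The part of degree \<open>|\<alpha>| + |\<beta>| - 1\<close> of the operator, applied to the monomial \<open>m \<alpha> \<beta>\<close>.  The sum over
  \<open>j \<noteq> l\<close> comes from the Laguerre operators, the other two terms from \<open>\<parallel>x\<parallel> \<Delta>\<close>.  The argument \<open>m\<close> is a
  parameter because the same combination is formed of monomials and of their moments.
\<close>

definition low_terms :: "real ^ 'b \<Rightarrow> 'b \<Rightarrow> (('a::finite \<Rightarrow> nat) \<Rightarrow> ('b::finite \<Rightarrow> nat) \<Rightarrow> real)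
    \<Rightarrow> ('a \<Rightarrow> nat) \<times> ('b \<Rightarrow> nat) \<Rightarrow> real"
  where "low_terms \<kappa> l m = (\<lambda>(\<alpha>, \<beta>).
    (\<Sum>j\<in>UNIV - {l}. real (\<beta> j) * (real (\<beta> j) + \<kappa> $ j) * m \<alpha> (\<beta>(j := \<beta> j - 1)))
    + real (\<beta> l) * (2 * real (sum \<alpha> UNIV) + real (\<beta> l) + real CARD('a) - 2) * m \<alpha> (\<beta>(l := \<beta> l - 1))
    + (\<Sum>i\<in>UNIV. real (\<alpha> i) * (real (\<alpha> i) - 1) * m (\<alpha>(i := \<alpha> i - 2)) (\<beta>(l := \<beta> l + 1))))"

text \<open>
  The image of the adapted monomial \<open>i\<close> under the operator (\<open>D_op_amonoms\<close>).
\<close>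

definition gen_monom :: "real ^ 'b \<Rightarrow> 'b \<Rightarrow> ('a::finite \<Rightarrow> nat) \<times> ('b::finite \<Rightarrow> nat)
    \<Rightarrow> (real ^ 'a) \<times> (real ^ 'b) \<Rightarrow> real"
  where "gen_monom \<kappa> l i p = low_terms \<kappa> l (\<lambda>\<alpha> \<beta>. amonom l (\<alpha>, \<beta>) p) i
    - real (sum (fst i) UNIV + sum (snd i) UNIV) * amonom l i p"

text \<open>
  The weighted integral of \<open>gen_monom \<kappa> l i * amonom l j\<close> (\<open>has_bochner_integral_gen_form\<close>), expressed
  through moments.
\<close>

definition gen_form :: "real ^ 'b \<Rightarrow> 'b \<Rightarrow> ('a::finite \<Rightarrow> nat) \<times> ('b::finite \<Rightarrow> nat)
    \<Rightarrow> ('a \<Rightarrow> nat) \<times> ('b \<Rightarrow> nat) \<Rightarrow> real"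
  where "gen_form \<kappa> l i j =
    low_terms \<kappa> l (\<lambda>\<alpha> \<beta>. moment \<kappa> l (\<lambda>k. \<alpha> k + fst j k) (\<lambda>k. \<beta> k + snd j k)) i
    - real (sum (fst i) UNIV + sum (snd i) UNIV)
      * moment \<kappa> l (\<lambda>k. fst i k + fst j k) (\<lambda>k. snd i k + snd j k)"

lemma amonom_mult:
  "amonom l (\<alpha>, \<beta>) p * amonom l j p = amonom l (\<lambda>k. \<alpha> k + fst j k, \<lambda>k. \<beta> k + snd j k) p"
  by (simp add: amonom_def vmonom_add)

lemma has_bochner_integral_gen_form:
  fixes i j :: "('a::finite \<Rightarrow> nat) \<times> ('b::finite \<Rightarrow> nat)"
  assumes "CARD('a) \<ge> 2" "\<And>i. i \<noteq> l \<Longrightarrow> \<kappa> $ i > -1" "\<kappa> $ l = -1"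
  shows "has_bochner_integral (graph_coords l)
    (\<lambda>p. indicator (surf l) (graph_map l p) *
      (gen_monom \<kappa> l i (graph_map l p) * amonom l j (graph_map l p) * weight \<kappa> l (snd (graph_map l p))))
    (gen_form \<kappa> l i j)"
proof -
  let ?w = "\<lambda>p. indicator (surf l) (graph_map l p) * weight \<kappa> l (snd (graph_map l p))"
  let ?m = "\<lambda>\<alpha> \<beta> p. ?w p * (amonom l (\<alpha>, \<beta>) (graph_map l p) * amonom l j (graph_map l p))"
  have base: "has_bochner_integral (graph_coords l) (?m \<alpha> \<beta>)
      (moment \<kappa> l (\<lambda>k. \<alpha> k + fst j k) (\<lambda>k. \<beta> k + snd j k))" for \<alpha> \<beta>
  proof -
    have "?m \<alpha> \<beta> = (\<lambda>p. indicator (surf l) (graph_map l p) *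
        (amonom l (\<lambda>k. \<alpha> k + fst j k, \<lambda>k. \<beta> k + snd j k) (graph_map l p)
          * weight \<kappa> l (snd (graph_map l p))))"
      by (simp add: fun_eq_iff amonom_mult[of l \<alpha> \<beta> _ j, symmetric] mult_ac)
    then show ?thesis
      using weighted_monom_integral[OF assms] by simp
  qed
  obtain \<alpha> \<beta> where i: "i = (\<alpha>, \<beta>)" by (cases i)
  have "has_bochner_integral (graph_coords l)
      (\<lambda>p. low_terms \<kappa> l (\<lambda>\<alpha> \<beta>. ?m \<alpha> \<beta> p) i - real (sum (fst i) UNIV + sum (snd i) UNIV) * ?m (fst i) (snd i) p)
      (gen_form \<kappa> l i j)"
    unfolding gen_form_def low_terms_def i prod.case fst_conv snd_conv
    by (intro has_bochner_integral_diff has_bochner_integral_add has_bochner_integral_sum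
        has_bochner_integral_mult_right base[unfolded i fst_conv snd_conv])
  moreover have "low_terms \<kappa> l (\<lambda>\<alpha> \<beta>. ?m \<alpha> \<beta> p) i - real (sum (fst i) UNIV + sum (snd i) UNIV) * ?m (fst i) (snd i) p
      = indicator (surf l) (graph_map l p) *
      (gen_monom \<kappa> l i (graph_map l p) * amonom l j (graph_map l p) * weight \<kappa> l (snd (graph_map l p)))" for p
  proof -
    have "low_terms \<kappa> l (\<lambda>\<alpha> \<beta>. ?m \<alpha> \<beta> p) i =
        ?w p * amonom l j (graph_map l p) * low_terms \<kappa> l (\<lambda>\<alpha> \<beta>. amonom l (\<alpha>, \<beta>) (graph_map l p)) i"
      unfolding low_terms_def i prod.case
      by (simp add: distrib_left sum_distrib_left mult_ac)
    then show ?thesis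
      by (simp add: gen_monom_def algebra_simps)
  qed
  ultimately show ?thesis by simp
qed

lemma moment_Gamma_step:
  assumes "j \<noteq> l" "\<kappa> $ j > -1" "b j \<noteq> 0"
  shows "moment \<kappa> l a b = (real (b j) + \<kappa> $ j) * moment \<kappa> l a (b(j := b j - 1))"
proof -
  define R where "R = (\<Prod>i\<in>UNIV - {l} - {j}. Gamma (real (b i) + \<kappa> $ i + 1))"
  have R: "(\<Prod>i\<in>UNIV - {l} - {j}. Gamma (real ((b(j := b j - 1)) i) + \<kappa> $ i + 1)) = R"
    unfolding R_def by (rule prod.cong) auto
  have "j \<in> UNIV - {l}" using assms by simp
  then have 1: "(\<Prod>i\<in>UNIV - {l}. Gamma (real (b i) + \<kappa> $ i + 1)) = Gamma (real (b j) + \<kappa> $ j + 1) * R"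
    and 2: "(\<Prod>i\<in>UNIV - {l}. Gamma (real ((b(j := b j - 1)) i) + \<kappa> $ i + 1)) = Gamma (real (b j) + \<kappa> $ j) * R"
    using assms by (simp_all add: prod.remove[of _ j] R R_def del: fun_upd_apply) (simp add: of_nat_diff)
  have pos: "real (b j) + \<kappa> $ j > 0" using assms by simp
  have "Gamma (real (b j) + \<kappa> $ j + 1) = (real (b j) + \<kappa> $ j) * Gamma (real (b j) + \<kappa> $ j)"
    using pos by (intro Gamma_plus1) (auto elim!: nonpos_Ints_cases)
  then show ?thesis
    using assms(1) unfolding moment_def 1 2 by (simp add: mult_ac)
qed

lemma moment_radial_step:
  fixes a :: "'a::finite \<Rightarrow> nat"
  assumes "CARD('a) \<ge> 2" "b l \<noteq> 0"
  shows "moment \<kappa> l a b = (real (sum a UNIV) + real (b l) + real CARD('a) - 2) * moment \<kappa> l a (b(l := b l - 1))"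
proof -
  have G: "(\<Prod>j\<in>UNIV - {l}. Gamma (real ((b(l := b l - 1)) j) + \<kappa> $ j + 1)) =
      (\<Prod>j\<in>UNIV - {l}. Gamma (real (b j) + \<kappa> $ j + 1))"
    by (rule prod.cong) auto
  have "radial_moment a (int (b l) - 2 + 1) =
      (real (sum a UNIV) + of_int (int (b l) - 2) + real CARD('a)) * radial_moment a (int (b l) - 2)"
    using assms by (intro radial_moment_Suc) linarith+
  moreover have "int (b l) - 2 + 1 = int (b l) - 1" "int ((b(l := b l - 1)) l) - 1 = int (b l) - 2"
    using assms by auto
  ultimately have "radial_moment a (int (b l) - 1) =
      (real (sum a UNIV) + real (b l) + real CARD('a) - 2) * radial_moment a (int ((b(l := b l - 1)) l) - 1)"
    by (simp add: algebra_simps)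
  then show ?thesis
    unfolding moment_def G by (simp only: mult.assoc)
qed

text \<open>
  Integration by parts for \<open>x\<^bsup>a - e\<^sub>i\<^esup> \<parallel>x\<parallel>\<^bsup>b\<^sub>l\<^esup> e\<^bsup>-\<parallel>x\<parallel>\<^esup>\<close>.  It removes the second derivatives in \<open>x\<close> from the
  symmetry identity.
\<close>

lemma moment_spherical_step:
  fixes a :: "'a::finite \<Rightarrow> nat"
  assumes "CARD('a) \<ge> 2" "a i \<noteq> 0"
  shows "(real (a i) - 1) * moment \<kappa> l (a(i := a i - 2)) (b(l := b l + 1))
    = moment \<kappa> l a b - real (b l) * moment \<kappa> l a (b(l := b l - 1))"
proof -
  have G: "(\<Prod>j\<in>UNIV - {l}. Gamma (real ((b(l := k)) j) + \<kappa> $ j + 1)) =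
      (\<Prod>j\<in>UNIV - {l}. Gamma (real (b j) + \<kappa> $ j + 1))" for k
    by (rule prod.cong) auto
  have s: "int (sum (a(i := a i - 1)) UNIV) + int (b l) \<ge> 0" by linarith
  have "real (a i - 1) * radial_moment (a(i := a i - 2)) (int (b l))
      + of_int (int (b l)) * radial_moment a (int (b l) - 2) = radial_moment a (int (b l) - 1)"
    using radial_moment_by_parts[OF assms(1) s, of i] assms(2)
    by (simp add: numeral_2_eq_2)
  moreover have "real (b l) * radial_moment a (int (b l) - 2) = real (b l) * radial_moment a (int (b l - 1) - 1)"
    by (cases "b l") auto
  moreover have "real (a i - 1) = real (a i) - 1" using assms(2) by (simp add: of_nat_diff)
  ultimately have "radial_moment a (int (b l) - 1) - real (b l) * radial_moment a (int (b l - 1) - 1)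
      = (real (a i) - 1) * radial_moment (a(i := a i - 2)) (int (b l))" by simp
  then show ?thesis
    unfolding moment_def G by (simp add: mult.assoc[symmetric] left_diff_distrib[symmetric])
qed

text \<open>
  With \<open>a = \<alpha> + \<alpha>'\<close> and \<open>b = \<beta> + \<beta>'\<close>, both sides are combinations of the same moments.  Each term of the
  Laguerre parts contributes \<open>\<beta>\<^sub>j - \<beta>'\<^sub>j\<close> times the moment \<open>Y\<close> of \<open>(a, b)\<close> to the difference, and each
  second derivative in \<open>x\<close> contributes \<open>\<alpha>\<^sub>i - \<alpha>'\<^sub>i\<close> times the quantity \<open>Y - b\<^sub>l X\<close>, which is independent of
  \<open>i\<close>; here \<open>X\<close> is the moment with \<open>b\<^sub>l\<close> lowered by one.  What remains are multiples of \<open>X\<close> and \<open>Y\<close>, which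
  are related by \<open>moment_radial_step\<close>.
\<close>

lemma gen_form_commute:
  fixes i j :: "('a::finite \<Rightarrow> nat) \<times> ('b::finite \<Rightarrow> nat)"
  assumes dim: "CARD('a) \<ge> 2" and \<kappa>: "\<And>i. i \<noteq> l \<Longrightarrow> \<kappa> $ i > -1"
  shows "gen_form \<kappa> l i j = gen_form \<kappa> l j i"
proof -
  have half: "gen_form \<kappa> l (\<alpha>, \<beta>) (\<alpha>', \<beta>') =
      (\<Sum>j\<in>UNIV - {l}. real (\<beta> j) * (real (\<beta> j) + \<kappa> $ j) * moment \<kappa> l a (b(j := b j - 1)))
      + real (\<beta> l) * (2 * real (sum \<alpha> UNIV) + real (\<beta> l) + real CARD('a) - 2) * moment \<kappa> l a (b(l := b l - 1))
      + (\<Sum>i\<in>UNIV. real (\<alpha> i) * (real (\<alpha> i) - 1) * moment \<kappa> l (a(i := a i - 2)) (b(l := b l + 1)))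
      - real (sum \<alpha> UNIV + sum \<beta> UNIV) * moment \<kappa> l a b"
    if a: "a = (\<lambda>k. \<alpha> k + \<alpha>' k)" and b: "b = (\<lambda>k. \<beta> k + \<beta>' k)"
    for \<alpha> \<alpha>' a :: "'a \<Rightarrow> nat" and \<beta> \<beta>' b :: "'b \<Rightarrow> nat"
  proof -
    have \<beta>: "real (\<beta> j) * c * moment \<kappa> l a (\<lambda>k. (\<beta>(j := \<beta> j - 1)) k + \<beta>' k) =
        real (\<beta> j) * c * moment \<kappa> l a (b(j := b j - 1))" for j c
    proof (cases "\<beta> j = 0")
      case False
      then have "(\<lambda>k. (\<beta>(j := \<beta> j - 1)) k + \<beta>' k) = b(j := b j - 1)"
        by (auto simp: fun_eq_iff b)
      then show ?thesis by simp
    qed simp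
    have \<alpha>: "real (\<alpha> i) * (real (\<alpha> i) - 1)
          * moment \<kappa> l (\<lambda>k. (\<alpha>(i := \<alpha> i - 2)) k + \<alpha>' k) (\<lambda>k. (\<beta>(l := \<beta> l + 1)) k + \<beta>' k) =
        real (\<alpha> i) * (real (\<alpha> i) - 1) * moment \<kappa> l (a(i := a i - 2)) (b(l := b l + 1))" for i
    proof (cases "\<alpha> i \<ge> 2")
      case True
      then have "(\<lambda>k. (\<alpha>(i := \<alpha> i - 2)) k + \<alpha>' k) = a(i := a i - 2)"
        by (auto simp: fun_eq_iff a)
      moreover have "(\<lambda>k. (\<beta>(l := \<beta> l + 1)) k + \<beta>' k) = b(l := b l + 1)"
        by (auto simp: fun_eq_iff b)
      ultimately show ?thesis by simp
    next
      case False
      then have "\<alpha> i = 0 \<or> \<alpha> i = 1" by auto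
      then show ?thesis by auto
    qed
    show ?thesis
      unfolding gen_form_def low_terms_def prod.case fst_conv snd_conv a[symmetric] b[symmetric]
        \<beta> \<alpha> by (rule refl)
  qed
  obtain \<alpha> \<beta> \<alpha>' \<beta>' where ij: "i = (\<alpha>, \<beta>)" "j = (\<alpha>', \<beta>')" by (cases i, cases j)
  define a b where "a = (\<lambda>k. \<alpha> k + \<alpha>' k)" and "b = (\<lambda>k. \<beta> k + \<beta>' k)"
  define X Y where "X = moment \<kappa> l a (b(l := b l - 1))" and "Y = moment \<kappa> l a b"
  define M where "M = (\<lambda>j. moment \<kappa> l a (b(j := b j - 1)))"
  define Z where "Z = (\<lambda>i. moment \<kappa> l (a(i := a i - 2)) (b(l := b l + 1)))"
  have L: "real (\<beta> j) * (real (\<beta> j) + \<kappa> $ j) * M j - real (\<beta>' j) * (real (\<beta>' j) + \<kappa> $ j) * M j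
      = (real (\<beta> j) - real (\<beta>' j)) * Y" if "j \<in> UNIV - {l}" for j
  proof (cases "b j = 0")
    case True
    then show ?thesis by (simp add: b_def)
  next
    case False
    with that \<kappa> have "Y = (real (b j) + \<kappa> $ j) * M j"
      unfolding Y_def M_def by (intro moment_Gamma_step) auto
    then show ?thesis by (simp add: b_def algebra_simps)
  qed
  have S: "real (\<alpha> i) * (real (\<alpha> i) - 1) * Z i - real (\<alpha>' i) * (real (\<alpha>' i) - 1) * Z i
      = (real (\<alpha> i) - real (\<alpha>' i)) * (Y - real (b l) * X)" for i
  proof (cases "a i = 0")
    case True
    then show ?thesis by (simp add: a_def)
  next
    case False
    have "Y - real (b l) * X = (real (a i) - 1) * Z i"
      unfolding X_def Y_def Z_def by (rule moment_spherical_step[of a i, OF dim False, symmetric])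
    then show ?thesis by (simp only:) (simp add: a_def algebra_simps)
  qed
  define k k' where "k = real (sum \<alpha> UNIV)" and "k' = real (sum \<alpha>' UNIV)"
  define q q' where "q = (\<Sum>j\<in>UNIV - {l}. real (\<beta> j))" and "q' = (\<Sum>j\<in>UNIV - {l}. real (\<beta>' j))"
  define c c' where "c = real (\<beta> l)" and "c' = real (\<beta>' l)"
  define d where "d = real CARD('a)"
  have sL: "(\<Sum>j\<in>UNIV - {l}. real (\<beta> j) * (real (\<beta> j) + \<kappa> $ j) * M j)
      - (\<Sum>j\<in>UNIV - {l}. real (\<beta>' j) * (real (\<beta>' j) + \<kappa> $ j) * M j) = (q - q') * Y"
    unfolding sum_subtractf[symmetric] q_def q'_def sum_distrib_right by (rule sum.cong[OF refl L])
  have sS: "(\<Sum>i\<in>UNIV. real (\<alpha> i) * (real (\<alpha> i) - 1) * Z i)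
      - (\<Sum>i\<in>UNIV. real (\<alpha>' i) * (real (\<alpha>' i) - 1) * Z i) = (k - k') * (Y - real (b l) * X)"
    unfolding sum_subtractf[symmetric] k_def k'_def of_nat_sum sum_distrib_right by (rule sum.cong[OF refl S])
  have sb: "real (sum \<alpha> UNIV + sum \<beta> UNIV) = k + c + q" "real (sum \<alpha>' UNIV + sum \<beta>' UNIV) = k' + c' + q'"
    by (simp_all add: k_def k'_def c_def c'_def q_def q'_def sum.remove[of UNIV l])
  \<comment> \<open>if \<open>b\<^sub>l = 0\<close>, the exponent in \<open>X\<close> is truncated, but then \<open>c = c' = 0\<close>\<close>
  have key: "c * (2 * k + c + d - 2) * X - c' * (2 * k' + c' + d - 2) * X
      = (c - c') * Y + (k - k') * (c + c') * X"
  proof (cases "b l = 0")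
    case True
    then show ?thesis by (simp add: b_def c_def c'_def)
  next
    case False
    then have "Y = (k + k' + (c + c') + d - 2) * X"
      using moment_radial_step[OF dim, of b l \<kappa> a]
      by (simp add: X_def Y_def k_def k'_def c_def c'_def d_def a_def b_def sum.distrib)
    then show ?thesis by (simp only:) (simp add: algebra_simps)
  qed
  have 1: "gen_form \<kappa> l i j =
      (\<Sum>j\<in>UNIV - {l}. real (\<beta> j) * (real (\<beta> j) + \<kappa> $ j) * M j) + c * (2 * k + c + d - 2) * X
      + (\<Sum>i\<in>UNIV. real (\<alpha> i) * (real (\<alpha> i) - 1) * Z i) - (k + c + q) * Y"
    unfolding ij half[OF a_def b_def] sb M_def Z_def X_def Y_def c_def k_def d_def by (rule refl)
  have "a = (\<lambda>k. \<alpha>' k + \<alpha> k)" "b = (\<lambda>k. \<beta>' k + \<beta> k)"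
    by (simp_all add: a_def b_def add.commute)
  note half' = half[OF this]
  have 2: "gen_form \<kappa> l j i =
      (\<Sum>j\<in>UNIV - {l}. real (\<beta>' j) * (real (\<beta>' j) + \<kappa> $ j) * M j) + c' * (2 * k' + c' + d - 2) * X
      + (\<Sum>i\<in>UNIV. real (\<alpha>' i) * (real (\<alpha>' i) - 1) * Z i) - (k' + c' + q') * Y"
    unfolding ij half' sb M_def Z_def X_def Y_def c'_def k'_def d_def by (rule refl)
  have "real (b l) = c + c'"
    by (simp add: b_def c_def c'_def)
  with 1 2 sL sS have "gen_form \<kappa> l i j - gen_form \<kappa> l j i =
      (q - q') * Y + (c * (2 * k + c + d - 2) * X - c' * (2 * k' + c' + d - 2) * X)
      + (k - k') * (Y - (c + c') * X) - (k + c + q) * Y + (k' + c' + q') * Y"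
    by simp
  also have "\<dots> = 0"
    unfolding key by (simp add: algebra_simps)
  finally show ?thesis by simp
qed

section \<open>The operator as a differential operator\<close>

text \<open>
  One rule for both uses of \<open>pdiff\<close>: within \<open>R_Sigma\<close>, where every point can be moved in the positive
  direction of each axis and so the one-sided derivative is unique, and in the whole space near a point
  of the sphere, where the formula for \<open>f\<close> is only known off the origin.
\<close>

lemma pdiff_eqI:
  assumes S: "y \<in> S" "\<And>t. t > 0 \<Longrightarrow> y + t *\<^sub>R axis i 1 \<in> S"
    and V: "open V" "y \<in> V"
    and eq: "\<And>z. z \<in> S \<inter> V \<Longrightarrow> f z = g z"
    and der: "((\<lambda>t. g (y + t *\<^sub>R axis i 1)) has_real_derivative g') (at 0)"
  shows "pdiff S i f y = g'"
proof -
  let ?T = "{t. y + t *\<^sub>R axis i 1 \<in> S}"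
  have "at_right (0::real) \<le> at 0 within ?T"
    using S by (intro at_le) auto
  then have nb: "at (0::real) within ?T \<noteq> bot"
    using le_bot[of "at_right (0::real)"] by force
  have "continuous_on UNIV (\<lambda>t::real. y + t *\<^sub>R axis i 1)"
    by (intro continuous_intros)
  from open_vimage[OF V(1) this] have "open {t::real. y + t *\<^sub>R axis i 1 \<in> V}"
    by (simp add: vimage_def)
  moreover have "(0::real) \<in> {t. y + t *\<^sub>R axis i 1 \<in> V}"
    using V(2) by simp
  ultimately obtain e where e: "e > 0" "\<And>t::real. dist t 0 < e \<Longrightarrow> y + t *\<^sub>R axis i 1 \<in> V"
    unfolding open_dist by blast
  have "((\<lambda>t. g (y + t *\<^sub>R axis i 1)) has_vector_derivative g') (at 0 within ?T)"
    using der by (simp add: has_real_derivative_iff_has_vector_derivative has_vector_derivative_at_within)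
  then have "((\<lambda>t. f (y + t *\<^sub>R axis i 1)) has_vector_derivative g') (at 0 within ?T)"
    by (rule has_vector_derivative_transform_within[OF _ e(1)]) (use S e(2) eq in auto)
  then show ?thesis
    unfolding pdiff_def by (rule vector_derivative_within[OF nb])
qed

lemma has_real_derivative_linear_combination:
  assumes "\<And>k. k \<in> K \<Longrightarrow> (F k has_real_derivative F' k) (at x)"
  shows "((\<lambda>t. \<Sum>k\<in>K. C k * F k t) has_real_derivative (\<Sum>k\<in>K. C k * F' k)) (at x)"
  using assms by (intro DERIV_sum DERIV_cmult)

lemma coord_sum_line: "coord_sum (y + t *\<^sub>R axis i 1) = coord_sum y + t"
  unfolding coord_sum_remove[of _ i] by (simp add: axis_def)

lemma R_Sigma_line: "y \<in> R_Sigma l \<Longrightarrow> t > 0 \<Longrightarrow> y + t *\<^sub>R axis i 1 \<in> R_Sigma l"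
  unfolding R_Sigma_def mem_Collect_eq coord_sum_line by (auto simp: axis_def)

lemma vmonom_adapt: "vmonom \<gamma> (adapt l y) = coord_sum y ^ \<gamma> l * vmonom (\<gamma>(l := 0)) y"
  unfolding vmonom_split[of \<gamma> "adapt l y" l] vmonom_upd by (auto intro!: prod.cong)

text \<open>
  First and second derivatives of a monomial in the adapted coordinates \<open>(y', t)\<close>.  The partial
  derivatives in the coordinates \<open>y\<close> are sums of these, because moving any \<open>y\<^sub>i\<close> also moves \<open>t = |y|\<close>
  (\<open>monom_adapt_line\<close>).
\<close>

definition dmonom :: "'b \<Rightarrow> 'b \<Rightarrow> ('b::finite \<Rightarrow> nat) \<Rightarrow> real ^ 'b \<Rightarrow> real"
  where "dmonom l j \<gamma> y = real (\<gamma> j) * vmonom (\<gamma>(j := \<gamma> j - 1)) (adapt l y)"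

definition ddmonom :: "'b \<Rightarrow> 'b \<Rightarrow> 'b \<Rightarrow> ('b::finite \<Rightarrow> nat) \<Rightarrow> real ^ 'b \<Rightarrow> real"
  where "ddmonom l j i \<gamma> y = real (\<gamma> j) * dmonom l i (\<gamma>(j := \<gamma> j - 1)) y"

lemma ddmonom_commute: "ddmonom l i j \<gamma> y = ddmonom l j i \<gamma> y"
  by (cases "i = j") (auto simp: ddmonom_def dmonom_def fun_upd_twist)

lemma monom_adapt_line:
  "((\<lambda>t. vmonom \<gamma> (adapt l (y + t *\<^sub>R axis i 1))) has_real_derivative
    dmonom l l \<gamma> y + (if i = l then 0 else dmonom l i \<gamma> y)) (at 0)"
proof -
  have "((\<lambda>t. (coord_sum y + t) ^ \<gamma> l * vmonom (\<gamma>(l := 0)) (y + t *\<^sub>R axis i 1)) has_real_derivative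
      real (\<gamma> l) * coord_sum y ^ (\<gamma> l - 1) * vmonom (\<gamma>(l := 0)) y
      + coord_sum y ^ \<gamma> l * (real ((\<gamma>(l := 0)) i) * vmonom ((\<gamma>(l := 0))(i := (\<gamma>(l := 0)) i - 1)) y)) (at 0)"
    using vmonom_line[of "\<gamma>(l := 0)" y i 0] by (auto intro!: derivative_eq_intros)
  moreover have "real (\<gamma> l) * coord_sum y ^ (\<gamma> l - 1) * vmonom (\<gamma>(l := 0)) y = dmonom l l \<gamma> y"
    by (simp add: dmonom_def vmonom_adapt)
  moreover have "coord_sum y ^ \<gamma> l * (real ((\<gamma>(l := 0)) i) * vmonom ((\<gamma>(l := 0))(i := (\<gamma>(l := 0)) i - 1)) y)
      = (if i = l then 0 else dmonom l i \<gamma> y)"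
    by (auto simp: dmonom_def vmonom_adapt fun_upd_twist)
  ultimately show ?thesis
    by (simp add: vmonom_adapt coord_sum_line)
qed

lemma dmonom_line:
  "((\<lambda>t. dmonom l j \<gamma> (y + t *\<^sub>R axis i 1)) has_real_derivative
    ddmonom l j l \<gamma> y + (if i = l then 0 else ddmonom l j i \<gamma> y)) (at 0)"
proof -
  have "((\<lambda>t. dmonom l j \<gamma> (y + t *\<^sub>R axis i 1)) has_real_derivative
    real (\<gamma> j) * (dmonom l l (\<gamma>(j := \<gamma> j - 1)) y + (if i = l then 0 else dmonom l i (\<gamma>(j := \<gamma> j - 1)) y))) (at 0)"
    unfolding dmonom_def[of l j] by (intro DERIV_cmult monom_adapt_line)
  then show ?thesis
    by (simp add: ddmonom_def distrib_left if_distrib cong: if_cong)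
qed

lemma pdiff_monoms:
  assumes U: "\<And>\<eta>. \<eta> \<in> R_Sigma l \<Longrightarrow> U \<eta> = (\<Sum>k\<in>K. C k * vmonom (\<gamma> k) (adapt l \<eta>))"
    and y: "y \<in> R_Sigma l"
  defines "D1 \<equiv> \<lambda>j. \<Sum>k\<in>K. C k * dmonom l j (\<gamma> k) y"
    and "D2 \<equiv> \<lambda>i j. \<Sum>k\<in>K. C k * ddmonom l i j (\<gamma> k) y"
  shows "pdiff (R_Sigma l) i U y = D1 l + (if i = l then 0 else D1 i)"
    and "pdiff (R_Sigma l) j (pdiff (R_Sigma l) i U) y =
      (D2 l l + (if j = l then 0 else D2 l j)) + (if i = l then 0 else D2 i l + (if j = l then 0 else D2 i j))"
proof -
  have first: "pdiff (R_Sigma l) i U \<eta> = (\<Sum>k\<in>K. C k * (dmonom l l (\<gamma> k) \<eta> + (if i = l then 0 else dmonom l i (\<gamma> k) \<eta>)))"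
    if \<eta>: "\<eta> \<in> R_Sigma l" for \<eta>
    by (rule pdiff_eqI[where V = UNIV and g = "\<lambda>\<eta>. \<Sum>k\<in>K. C k * vmonom (\<gamma> k) (adapt l \<eta>)"])
      (auto simp: U intro!: R_Sigma_line \<eta> has_real_derivative_linear_combination monom_adapt_line)
  show "pdiff (R_Sigma l) i U y = D1 l + (if i = l then 0 else D1 i)"
    unfolding first[OF y] D1_def by (auto simp: distrib_left sum.distrib)
  have "pdiff (R_Sigma l) j (pdiff (R_Sigma l) i U) y = (\<Sum>k\<in>K. C k *
      ((ddmonom l l l (\<gamma> k) y + (if j = l then 0 else ddmonom l l j (\<gamma> k) y)) +
       (if i = l then 0 else ddmonom l i l (\<gamma> k) y + (if j = l then 0 else ddmonom l i j (\<gamma> k) y))))"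
  proof (rule pdiff_eqI[where V = UNIV])
    show "pdiff (R_Sigma l) i U z =
        (\<Sum>k\<in>K. C k * (dmonom l l (\<gamma> k) z + (if i = l then 0 else dmonom l i (\<gamma> k) z)))"
      if "z \<in> R_Sigma l \<inter> UNIV" for z
      using that first by simp
    show "((\<lambda>t. \<Sum>k\<in>K. C k * (dmonom l l (\<gamma> k) (y + t *\<^sub>R axis j 1)
        + (if i = l then 0 else dmonom l i (\<gamma> k) (y + t *\<^sub>R axis j 1)))) has_real_derivative
      (\<Sum>k\<in>K. C k *
        ((ddmonom l l l (\<gamma> k) y + (if j = l then 0 else ddmonom l l j (\<gamma> k) y)) +
         (if i = l then 0 else ddmonom l i l (\<gamma> k) y + (if j = l then 0 else ddmonom l i j (\<gamma> k) y))))) (at 0)"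
      by (intro has_real_derivative_linear_combination DERIV_add dmonom_line)
        (simp add: dmonom_line)
  qed (use y R_Sigma_line in auto)
  then show "pdiff (R_Sigma l) j (pdiff (R_Sigma l) i U) y =
      (D2 l l + (if j = l then 0 else D2 l j)) + (if i = l then 0 else D2 i l + (if j = l then 0 else D2 i j))"
    unfolding D2_def by (auto simp: distrib_left sum.distrib)
qed

text \<open>
  The cancellation behind the definition of the operator: in adapted coordinates the mixed second
  derivatives disappear, and the variables separate.  \<open>D1\<close> and \<open>D2\<close> are first and second derivatives in the
  adapted coordinates; \<open>P\<close> and \<open>Q\<close> are the resulting derivatives in the coordinates \<open>y\<close>.
\<close>

lemma adapted_operator:
  fixes y \<kappa> :: "real ^ 'b" and l :: 'b and D1 :: "'b \<Rightarrow> real" and D2 :: "'b \<Rightarrow> 'b \<Rightarrow> real" and d :: real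
  assumes sym: "\<And>i j. D2 i j = D2 j i"
  defines "P \<equiv> \<lambda>i. D1 l + (if i = l then 0 else D1 i)"
    and "Q \<equiv> \<lambda>i j. (D2 l l + (if j = l then 0 else D2 l j))
      + (if i = l then 0 else D2 i l + (if j = l then 0 else D2 i j))"
  shows "(\<Sum>i\<in>UNIV. y $ i * Q i i + (\<kappa> $ i + 1 - y $ i) * P i)
      - 2 * (\<Sum>i\<in>UNIV. y $ i * Q l i) + 2 * coord_sum y * Q l l
      - (coord_sum \<kappa> - d + real CARD('b) + 1) * P l
    = (\<Sum>j\<in>UNIV - {l}. y $ j * D2 j j + (\<kappa> $ j + 1 - y $ j) * D1 j)
      + (coord_sum y * D2 l l + (d - 1 - coord_sum y) * D1 l)"
proof -
  let ?I = "UNIV - {l}"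
  have card: "real CARD('b) = 1 + (\<Sum>j\<in>?I. 1)"
    using sum.remove[of UNIV l "\<lambda>_. 1::real"] by simp
  have Q: "Q j j = D2 l l + 2 * D2 l j + D2 j j" "Q l j = D2 l l + D2 l j" "P j = D1 l + D1 j"
    if "j \<in> ?I" for j
    using that sym[of j l] by (simp_all add: P_def Q_def)
  have 3: "Q l l = D2 l l" "P l = D1 l" by (simp_all add: P_def Q_def)
  have 1: "(\<Sum>i\<in>UNIV. y $ i * Q i i + (\<kappa> $ i + 1 - y $ i) * P i) =
      y $ l * D2 l l + (\<kappa> $ l + 1 - y $ l) * D1 l
      + (\<Sum>j\<in>?I. y $ j * (D2 l l + 2 * D2 l j + D2 j j) + (\<kappa> $ j + 1 - y $ j) * (D1 l + D1 j))"
    unfolding sum.remove[OF finite UNIV_I, of _ l] 3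
    by (intro arg_cong2[where f = "(+)"] refl sum.cong) (simp_all only: Q)
  have 2: "(\<Sum>i\<in>UNIV. y $ i * Q l i) = y $ l * D2 l l + (\<Sum>j\<in>?I. y $ j * (D2 l l + D2 l j))"
    unfolding sum.remove[OF finite UNIV_I, of _ l] 3
    by (intro arg_cong2[where f = "(+)"] refl sum.cong) (simp_all only: Q)
  show ?thesis
    unfolding 1 2 3 coord_sum_remove[of _ l] card
    by (simp add: algebra_simps sum.distrib sum_subtractf sum_distrib_left sum_distrib_right)
qed

lemma dmonom_times: "adapt l y $ j * dmonom l j \<gamma> y = real (\<gamma> j) * vmonom \<gamma> (adapt l y)"
proof (cases "\<gamma> j")
  case (Suc m)
  then show ?thesis by (simp add: dmonom_def vmonom_upd vmonom_split[of \<gamma> _ j])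
qed (simp add: dmonom_def)

lemma ddmonom_times: "adapt l y $ j * ddmonom l j j \<gamma> y = (real (\<gamma> j) - 1) * dmonom l j \<gamma> y"
proof (cases "\<gamma> j")
  case (Suc m)
  then show ?thesis using dmonom_times[of l y j "\<gamma>(j := m)"] by (simp add: ddmonom_def dmonom_def mult_ac)
qed (simp add: ddmonom_def dmonom_def)

lemma kern_normalize:
  assumes "z \<noteq> 0"
  shows "vmonom \<alpha> (c *\<^sub>R (z /\<^sub>R norm z)) = c ^ sum \<alpha> UNIV * kern \<alpha> (- int (sum \<alpha> UNIV)) z"
  using assms by (simp add: vmonom_scale kern_def power_int_minus power_inverse power_mult_distrib mult_ac del: of_nat_sum)

text \<open>
  The extension of degree \<open>0\<close> of a monomial is \<open>x\<^sup>\<alpha> \<parallel>x\<parallel>\<^bsup>-k\<^esup>\<close> with \<open>k = |\<alpha>|\<close>, whose Laplacian on the sphere is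
  \<open>\<Delta> x\<^sup>\<alpha> - k (k + d - 2) x\<^sup>\<alpha>\<close>.
\<close>

lemma laplace_beltrami_monoms:
  fixes f :: "real ^ 'a \<Rightarrow> real" and \<alpha> :: "'k \<Rightarrow> 'a \<Rightarrow> nat"
  assumes f: "\<And>\<zeta>. norm \<zeta> = 1 \<Longrightarrow> f \<zeta> = (\<Sum>k\<in>K. C k * vmonom (\<alpha> k) \<zeta>)" and \<xi>: "norm \<xi> = 1"
  shows "laplace_beltrami f \<xi> = (\<Sum>k\<in>K. C k *
    ((\<Sum>i\<in>UNIV. real (\<alpha> k i) * (real (\<alpha> k i) - 1) * vmonom ((\<alpha> k)(i := \<alpha> k i - 2)) \<xi>)
      - real (sum (\<alpha> k) UNIV) * (real (sum (\<alpha> k) UNIV) + real CARD('a) - 2) * vmonom (\<alpha> k) \<xi>))"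
proof -
  define s where "s = (\<lambda>k. - int (sum (\<alpha> k) UNIV))"
  have V: "open (- {0 :: real ^ 'a})" by auto
  have \<xi>0: "\<xi> \<noteq> 0" using \<xi> by auto
  define g1 where "g1 = (\<lambda>k i z. real (\<alpha> k i) * kern ((\<alpha> k)(i := \<alpha> k i - 1)) (s k) z
    + of_int (s k) * kern ((\<alpha> k)(i := \<alpha> k i + 1)) (s k - 2) z)"
  define g2 where "g2 = (\<lambda>k i. real (\<alpha> k i) * (real (\<alpha> k i - 1) * vmonom ((\<alpha> k)(i := \<alpha> k i - 2)) \<xi>
      + of_int (s k) * vmonom ((\<alpha> k)(i := \<alpha> k i - 1 + 1)) \<xi>)
    + of_int (s k) * (real (\<alpha> k i + 1) * vmonom (\<alpha> k) \<xi>
      + of_int (s k - 2) * vmonom ((\<alpha> k)(i := \<alpha> k i + 2)) \<xi>))"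
  have first: "pdiff UNIV i (\<lambda>z. f (z /\<^sub>R norm z)) z = (\<Sum>k\<in>K. C k * g1 k i z)" if z: "z \<noteq> 0" for i z
  proof (rule pdiff_eqI[where V = "- {0}"])
    show "f (w /\<^sub>R norm w) = (\<Sum>k\<in>K. C k * kern (\<alpha> k) (s k) w)" if "w \<in> UNIV \<inter> - {0}" for w
      using that kern_normalize[of w _ 1] by (simp add: f s_def del: of_nat_sum)
    show "((\<lambda>t. \<Sum>k\<in>K. C k * kern (\<alpha> k) (s k) (z + t *\<^sub>R axis i 1)) has_real_derivative
        (\<Sum>k\<in>K. C k * g1 k i z)) (at 0)"
      unfolding g1_def using kern_line[of z 0 i] z
      by (intro has_real_derivative_linear_combination) simp
  qed (use V z in auto)
  have "pdiff UNIV i (pdiff UNIV i (\<lambda>z. f (z /\<^sub>R norm z))) \<xi> = (\<Sum>k\<in>K. C k * g2 k i)" for i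
  proof (rule pdiff_eqI[where V = "- {0}"])
    show "pdiff UNIV i (\<lambda>z. f (z /\<^sub>R norm z)) w = (\<Sum>k\<in>K. C k * g1 k i w)" if "w \<in> UNIV \<inter> - {0}" for w
      using that first by simp
    have "((\<lambda>t. g1 k i (\<xi> + t *\<^sub>R axis i 1)) has_real_derivative g2 k i) (at 0)" for k
    proof -
      have nz: "\<xi> + 0 *\<^sub>R axis i 1 \<noteq> 0" using \<xi>0 by simp
      have "((\<lambda>t. g1 k i (\<xi> + t *\<^sub>R axis i 1)) has_real_derivative
          (let a = (\<alpha> k)(i := \<alpha> k i - 1); b = (\<alpha> k)(i := \<alpha> k i + 1); z = \<xi> + 0 *\<^sub>R axis i 1 in
            real (\<alpha> k i) * (real (a i) * kern (a(i := a i - 1)) (s k) z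
              + of_int (s k) * kern (a(i := a i + 1)) (s k - 2) z)
            + of_int (s k) * (real (b i) * kern (b(i := b i - 1)) (s k - 2) z
              + of_int (s k - 2) * kern (b(i := b i + 1)) (s k - 2 - 2) z))) (at 0)"
        unfolding g1_def Let_def by (intro DERIV_add DERIV_cmult kern_line nz)
      then show ?thesis
        unfolding g2_def Let_def by (simp add: kern_def \<xi> numeral_2_eq_2)
    qed
    then show "((\<lambda>t. \<Sum>k\<in>K. C k * g1 k i (\<xi> + t *\<^sub>R axis i 1)) has_real_derivative
        (\<Sum>k\<in>K. C k * g2 k i)) (at 0)"
      by (intro has_real_derivative_linear_combination)
  qed (use V \<xi>0 in auto)
  then have "laplace_beltrami f \<xi> = (\<Sum>i\<in>UNIV. \<Sum>k\<in>K. C k * g2 k i)"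
    by (simp add: laplace_beltrami_def)
  also have "\<dots> = (\<Sum>k\<in>K. C k * (\<Sum>i\<in>UNIV. g2 k i))"
    unfolding sum_distrib_left by (rule sum.swap)
  also have "\<dots> = (\<Sum>k\<in>K. C k *
    ((\<Sum>i\<in>UNIV. real (\<alpha> k i) * (real (\<alpha> k i) - 1) * vmonom ((\<alpha> k)(i := \<alpha> k i - 2)) \<xi>)
      - real (sum (\<alpha> k) UNIV) * (real (sum (\<alpha> k) UNIV) + real CARD('a) - 2) * vmonom (\<alpha> k) \<xi>))"
  proof (intro sum.cong refl arg_cong[where f = "(*) _"])
    fix k
    define v where "v = vmonom (\<alpha> k) \<xi>"
    define N where "N = real (sum (\<alpha> k) UNIV)"
    have s: "of_int (s k) = - N" by (simp add: s_def N_def)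
    have g2: "g2 k i = real (\<alpha> k i) * (real (\<alpha> k i) - 1) * vmonom ((\<alpha> k)(i := \<alpha> k i - 2)) \<xi>
        - 2 * N * v * real (\<alpha> k i) - N * v + N * (N + 2) * v * (\<xi> $ i)\<^sup>2" for i
    proof -
      have 1: "real (\<alpha> k i) * real (\<alpha> k i - 1) = real (\<alpha> k i) * (real (\<alpha> k i) - 1)"
        by (cases "\<alpha> k i") auto
      have 2: "real (\<alpha> k i) * vmonom ((\<alpha> k)(i := \<alpha> k i - 1 + 1)) \<xi> = real (\<alpha> k i) * v"
        by (cases "\<alpha> k i = 0") (simp_all add: v_def fun_upd_idem)
      have 3: "vmonom ((\<alpha> k)(i := \<alpha> k i + 2)) \<xi> = (\<xi> $ i)\<^sup>2 * v"
        by (simp add: v_def vmonom_upd vmonom_split[of "\<alpha> k" \<xi> i] power2_eq_square)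
      have 4: "g2 k i = real (\<alpha> k i) * real (\<alpha> k i - 1) * vmonom ((\<alpha> k)(i := \<alpha> k i - 2)) \<xi>
          - N * (real (\<alpha> k i) * vmonom ((\<alpha> k)(i := \<alpha> k i - 1 + 1)) \<xi>)
          - N * (real (\<alpha> k i) + 1) * v + N * (N + 2) * vmonom ((\<alpha> k)(i := \<alpha> k i + 2)) \<xi>"
        unfolding g2_def by (simp add: s v_def algebra_simps)
      show ?thesis unfolding 4 1 2 3 by (simp add: algebra_simps)
    qed
    have "(\<Sum>i\<in>UNIV. (\<xi> $ i)\<^sup>2) = (norm \<xi>)\<^sup>2"
      by (simp add: norm_vec_def L2_set_def sum_nonneg)
    then have sq: "(\<Sum>i\<in>UNIV. N * (N + 2) * v * (\<xi> $ i)\<^sup>2) = N * (N + 2) * v"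
      using \<xi> by (simp flip: sum_distrib_left)
    have lin: "(\<Sum>i\<in>UNIV. 2 * N * v * real (\<alpha> k i)) = 2 * N * v * N"
      by (simp add: N_def sum_distrib_left)
    show "(\<Sum>i\<in>UNIV. g2 k i) =
        (\<Sum>i\<in>UNIV. real (\<alpha> k i) * (real (\<alpha> k i) - 1) * vmonom ((\<alpha> k)(i := \<alpha> k i - 2)) \<xi>)
        - real (sum (\<alpha> k) UNIV) * (real (sum (\<alpha> k) UNIV) + real CARD('a) - 2) * vmonom (\<alpha> k) \<xi>"
      unfolding g2 sum.distrib sum_subtractf sq lin N_def[symmetric] v_def[symmetric]
      by (simp add: algebra_simps)
  qed
  finally show ?thesis .
qed

text \<open>
  At \<open>x = t \<xi>\<close> an adapted monomial of exponents \<open>(\<alpha>, \<beta>)\<close> is \<open>\<xi>\<^sup>\<alpha>\<close> times the monomial \<open>\<gamma>\<close> in \<open>(y', t)\<close>, where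
  \<open>t\<close> has the exponent \<open>g = \<beta>\<^sub>l + |\<alpha>|\<close>.  The radial part contributes \<open>g (g + d - 2)\<close> and the spherical part
  \<open>- |\<alpha>| (|\<alpha>| + d - 2)\<close> times the same monomial divided by \<open>t\<close>.  The difference has the factor \<open>\<beta>\<^sub>l\<close>,
  so the division by \<open>t\<close> leaves a polynomial.
\<close>

lemma gen_monom_polar:
  fixes \<alpha> :: "'a::finite \<Rightarrow> nat" and \<beta> :: "'b::finite \<Rightarrow> nat" and \<kappa> y :: "real ^ 'b" and l :: 'b
  assumes t: "coord_sum y > 0"
  defines "N \<equiv> sum \<alpha> UNIV"
  defines "\<gamma> \<equiv> \<beta>(l := \<beta> l + N)"
  shows "vmonom \<alpha> \<xi> * ((\<Sum>j\<in>UNIV - {l}. y $ j * ddmonom l j j \<gamma> y + (\<kappa> $ j + 1 - y $ j) * dmonom l j \<gamma> y)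
        + (coord_sum y * ddmonom l l l \<gamma> y + (real CARD('a) - 1 - coord_sum y) * dmonom l l \<gamma> y))
      + 1 / coord_sum y * (coord_sum y ^ N * vmonom \<beta> (adapt l y) *
        ((\<Sum>i\<in>UNIV. real (\<alpha> i) * (real (\<alpha> i) - 1) * vmonom (\<alpha>(i := \<alpha> i - 2)) \<xi>)
          - real N * (real N + real CARD('a) - 2) * vmonom \<alpha> \<xi>))
    = gen_monom \<kappa> l (\<alpha>, \<beta>) (coord_sum y *\<^sub>R \<xi>, y)"
proof -
  define t where "t = coord_sum y"
  have t: "t > 0" using assms by (simp add: t_def)
  let ?A = "\<lambda>\<gamma>. vmonom \<gamma> (adapt l y)"
  let ?m = "\<lambda>\<alpha> \<beta>. amonom l (\<alpha>, \<beta>) (t *\<^sub>R \<xi>, y)"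
  have m: "?m \<alpha>' \<beta>' = t ^ sum \<alpha>' UNIV * vmonom \<alpha>' \<xi> * ?A \<beta>'" for \<alpha>' \<beta>'
    by (simp add: amonom_def vmonom_scale)
  have up: "?A (\<beta>'(l := \<beta>' l + n)) = t ^ n * ?A \<beta>'" for \<beta>' n
    by (simp add: vmonom_adapt power_add t_def)
  have lower: "real (\<beta>' l) * ?A (\<beta>'(l := \<beta>' l - 1)) = real (\<beta>' l) * ?A \<beta>' / t" for \<beta>'
    using dmonom_times[of l y l \<beta>'] t by (simp add: dmonom_def t_def field_simps)
  have J: "vmonom \<alpha> \<xi> * (y $ j * ddmonom l j j \<gamma> y + (\<kappa> $ j + 1 - y $ j) * dmonom l j \<gamma> y) =
      real (\<beta> j) * (real (\<beta> j) + \<kappa> $ j) * ?m \<alpha> (\<beta>(j := \<beta> j - 1)) - real (\<beta> j) * ?m \<alpha> \<beta>"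
    if j: "j \<in> UNIV - {l}" for j
  proof -
    have \<gamma>j: "\<gamma> j = \<beta> j" using j by (simp add: \<gamma>_def)
    have d: "dmonom l j \<gamma> y = real (\<beta> j) * (t ^ N * ?A (\<beta>(j := \<beta> j - 1)))"
    proof -
      have "\<gamma>(j := \<gamma> j - 1) = (\<beta>(j := \<beta> j - 1))(l := (\<beta>(j := \<beta> j - 1)) l + N)"
        using j by (auto simp: \<gamma>_def fun_eq_iff)
      then show ?thesis unfolding dmonom_def \<gamma>j by (simp only: up)
    qed
    have 1: "y $ j * dmonom l j \<gamma> y = real (\<beta> j) * (t ^ N * ?A \<beta>)"
      using dmonom_times[of l y j \<gamma>] j unfolding \<gamma>j unfolding \<gamma>_def up by simp
    have 2: "y $ j * ddmonom l j j \<gamma> y = (real (\<beta> j) - 1) * dmonom l j \<gamma> y"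
      using ddmonom_times[of l y j \<gamma>] j unfolding \<gamma>j by simp
    have 3: "y $ j * ddmonom l j j \<gamma> y + (\<kappa> $ j + 1 - y $ j) * dmonom l j \<gamma> y =
        (real (\<beta> j) + \<kappa> $ j) * dmonom l j \<gamma> y - y $ j * dmonom l j \<gamma> y"
      unfolding 2 by (simp add: algebra_simps)
    show ?thesis
      unfolding 3 1 unfolding d m N_def by (simp add: algebra_simps)
  qed
  define B where "B = t ^ N * ?A \<beta>"
  have \<gamma>l: "\<gamma> l = \<beta> l + N" "?A \<gamma> = B"
    unfolding B_def up[symmetric] by (simp_all add: \<gamma>_def)
  have L: "t * ddmonom l l l \<gamma> y + (real CARD('a) - 1 - t) * dmonom l l \<gamma> y =
      real (\<beta> l + N) * (real (\<beta> l + N) + real CARD('a) - 2) * B / t - real (\<beta> l + N) * B"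
  proof -
    have 1: "t * dmonom l l \<gamma> y = real (\<beta> l + N) * B"
      using dmonom_times[of l y l \<gamma>] unfolding \<gamma>l by (simp add: t_def)
    then have 3: "dmonom l l \<gamma> y = real (\<beta> l + N) * B / t"
      using t by (simp add: field_simps)
    have 2: "t * ddmonom l l l \<gamma> y = (real (\<beta> l + N) - 1) * dmonom l l \<gamma> y"
      using ddmonom_times[of l y l \<gamma>] unfolding \<gamma>l by (simp add: t_def)
    have 4: "t * ddmonom l l l \<gamma> y + (real CARD('a) - 1 - t) * dmonom l l \<gamma> y =
        (real (\<beta> l + N) + real CARD('a) - 2) * dmonom l l \<gamma> y - t * dmonom l l \<gamma> y"
      unfolding 2 by (simp add: algebra_simps)
    show ?thesis unfolding 4 1 unfolding 3 by simp
  qed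
  have S: "real (\<alpha> i) * (real (\<alpha> i) - 1) * ?m (\<alpha>(i := \<alpha> i - 2)) (\<beta>(l := \<beta> l + 1)) =
      B / t * (real (\<alpha> i) * (real (\<alpha> i) - 1) * vmonom (\<alpha>(i := \<alpha> i - 2)) \<xi>)" for i
  proof (cases "\<alpha> i \<ge> 2")
    case True
    then have "N = sum (\<alpha>(i := \<alpha> i - 2)) UNIV + 2"
      using sum_upd[of \<alpha> i "\<alpha> i - 2"] by (simp add: N_def)
    then show ?thesis
      unfolding m up B_def using t by (simp add: power_add power2_eq_square)
  next
    case False
    then have "\<alpha> i = 0 \<or> \<alpha> i = 1" by auto
    then show ?thesis by auto
  qed
  have low: "real (\<beta> l) * ?m \<alpha> (\<beta>(l := \<beta> l - 1)) = real (\<beta> l) * vmonom \<alpha> \<xi> * B / t"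
  proof -
    have "real (\<beta> l) * ?m \<alpha> (\<beta>(l := \<beta> l - 1)) =
        t ^ N * vmonom \<alpha> \<xi> * (real (\<beta> l) * ?A (\<beta>(l := \<beta> l - 1)))"
      unfolding m N_def by simp
    also have "\<dots> = real (\<beta> l) * vmonom \<alpha> \<xi> * B / t"
      unfolding lower B_def by simp
    finally show ?thesis .
  qed
  have mB: "?m \<alpha> \<beta> = vmonom \<alpha> \<xi> * B" by (simp add: m N_def B_def)
  have deg: "real (N + sum \<beta> UNIV) = real (\<beta> l + N) + (\<Sum>j\<in>UNIV - {l}. real (\<beta> j))"
    by (simp add: sum.remove[of UNIV l])
  have gen: "gen_monom \<kappa> l (\<alpha>, \<beta>) (t *\<^sub>R \<xi>, y) =
      (\<Sum>j\<in>UNIV - {l}. real (\<beta> j) * (real (\<beta> j) + \<kappa> $ j) * ?m \<alpha> (\<beta>(j := \<beta> j - 1)))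
      + (2 * real N + real (\<beta> l) + real CARD('a) - 2) * (real (\<beta> l) * ?m \<alpha> (\<beta>(l := \<beta> l - 1)))
      + (\<Sum>i\<in>UNIV. real (\<alpha> i) * (real (\<alpha> i) - 1) * ?m (\<alpha>(i := \<alpha> i - 2)) (\<beta>(l := \<beta> l + 1)))
      - (real (\<beta> l + N) + (\<Sum>j\<in>UNIV - {l}. real (\<beta> j))) * ?m \<alpha> \<beta>"
    unfolding gen_monom_def low_terms_def prod.case fst_conv snd_conv N_def[symmetric] deg
    by (simp add: mult_ac)
  have JS: "vmonom \<alpha> \<xi> * (\<Sum>j\<in>UNIV - {l}. y $ j * ddmonom l j j \<gamma> y + (\<kappa> $ j + 1 - y $ j) * dmonom l j \<gamma> y) =
      (\<Sum>j\<in>UNIV - {l}. real (\<beta> j) * (real (\<beta> j) + \<kappa> $ j) * ?m \<alpha> (\<beta>(j := \<beta> j - 1)))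
      - (\<Sum>j\<in>UNIV - {l}. real (\<beta> j)) * ?m \<alpha> \<beta>"
    unfolding sum_distrib_left sum_distrib_right sum_subtractf[symmetric] by (rule sum.cong[OF refl J])
  have SS: "(\<Sum>i\<in>UNIV. real (\<alpha> i) * (real (\<alpha> i) - 1) * ?m (\<alpha>(i := \<alpha> i - 2)) (\<beta>(l := \<beta> l + 1))) =
      B / t * (\<Sum>i\<in>UNIV. real (\<alpha> i) * (real (\<alpha> i) - 1) * vmonom (\<alpha>(i := \<alpha> i - 2)) \<xi>)"
    unfolding sum_distrib_left by (rule sum.cong[OF refl S])
  define W where "W = (\<Sum>i\<in>UNIV. real (\<alpha> i) * (real (\<alpha> i) - 1) * vmonom (\<alpha>(i := \<alpha> i - 2)) \<xi>)"
  show ?thesis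
    unfolding t_def[symmetric] distrib_left[of "vmonom \<alpha> \<xi>"] JS L gen SS low mB
      B_def[symmetric] W_def[symmetric]
    by (simp add: algebra_simps add_divide_distrib diff_divide_distrib)
qed

section \<open>The eigenvalue equation\<close>

lemma linear_combination_swap:
  fixes a e :: "'j \<Rightarrow> 'k \<Rightarrow> real" and C p q :: "'k \<Rightarrow> real"
  shows "(\<Sum>j\<in>J. s j * (\<Sum>k\<in>K. C k * a j k) + b j * (\<Sum>k\<in>K. C k * e j k))
      + (S * (\<Sum>k\<in>K. C k * p k) + T * (\<Sum>k\<in>K. C k * q k))
    = (\<Sum>k\<in>K. C k * ((\<Sum>j\<in>J. s j * a j k + b j * e j k) + (S * p k + T * q k)))"
proof -
  have "(\<Sum>j\<in>J. s j * (\<Sum>k\<in>K. C k * a j k) + b j * (\<Sum>k\<in>K. C k * e j k))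
      = (\<Sum>j\<in>J. \<Sum>k\<in>K. C k * (s j * a j k + b j * e j k))"
    by (simp add: sum_distrib_left sum.distrib distrib_left mult_ac)
  also have "\<dots> = (\<Sum>k\<in>K. C k * (\<Sum>j\<in>J. s j * a j k + b j * e j k))"
    unfolding sum_distrib_left by (rule sum.swap)
  finally show ?thesis
    by (simp add: sum_distrib_left sum.distrib distrib_left mult_ac)
qed

text \<open>
  With \<open>\<xi>\<close> fixed, an adapted monomial is a monomial in \<open>(y', t)\<close>, as \<open>x = t \<xi>\<close>; with \<open>y\<close> fixed it is a multiple
  of \<open>\<xi>\<^sup>\<alpha>\<close>.  So both parts of the operator act on linear combinations of monomials.
\<close>

lemma D_op_amonoms:
  fixes K :: "(('a::finite \<Rightarrow> nat) \<times> ('b::finite \<Rightarrow> nat)) set" and c and l :: 'b and \<kappa> :: "real ^ 'b"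
  defines "P \<equiv> \<lambda>p. \<Sum>i\<in>K. c i * amonom l i p"
  assumes p: "(x, y) \<in> surf l" and t: "coord_sum y > 0"
  shows "D_op \<kappa> l (restrict P (surf l)) (x, y) = (\<Sum>i\<in>K. c i * gen_monom \<kappa> l i (x, y))"
proof -
  define t where "t = coord_sum y"
  define \<xi> where "\<xi> = x /\<^sub>R norm x"
  define N where "N = (\<lambda>i :: ('a \<Rightarrow> nat) \<times> ('b \<Rightarrow> nat). sum (fst i) UNIV)"
  define \<gamma> where "\<gamma> = (\<lambda>i :: ('a \<Rightarrow> nat) \<times> ('b \<Rightarrow> nat). (snd i)(l := snd i l + N i))"
  define C where "C = (\<lambda>i. c i * vmonom (fst i) \<xi>)"
  have t: "t > 0" using assms by (simp add: t_def)
  have y: "y \<in> R_Sigma l" and nx: "norm x = t" using p by (simp_all add: surf_def t_def)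
  have \<xi>: "norm \<xi> = 1" and x: "x = t *\<^sub>R \<xi>" using nx t by (auto simp: \<xi>_def)
  define U where "U = (\<lambda>\<eta>. restrict P (surf l) (coord_sum \<eta> *\<^sub>R \<xi>, \<eta>))"
  have U: "U \<eta> = (\<Sum>i\<in>K. C i * vmonom (\<gamma> i) (adapt l \<eta>))" if \<eta>: "\<eta> \<in> R_Sigma l" for \<eta>
  proof -
    have "(coord_sum \<eta> *\<^sub>R \<xi>, \<eta>) \<in> surf l"
      using \<eta> \<xi> by (simp add: surf_def R_Sigma_def)
    then show ?thesis
      unfolding U_def P_def C_def
      by (auto simp: amonom_def vmonom_scale \<gamma>_def N_def vmonom_adapt power_add intro!: sum.cong)
  qed
  define D1 where "D1 = (\<lambda>j. \<Sum>i\<in>K. C i * dmonom l j (\<gamma> i) y)"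
  define D2 where "D2 = (\<lambda>j j'. \<Sum>i\<in>K. C i * ddmonom l j j' (\<gamma> i) y)"
  have d: "pdiff (R_Sigma l) j U y = D1 l + (if j = l then 0 else D1 j)"
    "pdiff (R_Sigma l) j' (pdiff (R_Sigma l) j U) y = (D2 l l + (if j' = l then 0 else D2 l j'))
      + (if j = l then 0 else D2 j l + (if j' = l then 0 else D2 j j'))" for j j'
    unfolding D1_def D2_def by (rule pdiff_monoms[OF U y]; assumption)+
  have sym: "D2 j j' = D2 j' j" for j j'
    unfolding D2_def by (simp only: ddmonom_commute)
  have f: "restrict P (surf l) (t *\<^sub>R \<zeta>, y) =
      (\<Sum>i\<in>K. c i * (t ^ N i * vmonom (snd i) (adapt l y)) * vmonom (fst i) \<zeta>)" if "norm \<zeta> = 1" for \<zeta>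
  proof -
    have "(t *\<^sub>R \<zeta>, y) \<in> surf l"
      using y that t by (simp add: surf_def t_def)
    then show ?thesis
      unfolding P_def by (auto simp: amonom_def vmonom_scale N_def mult_ac intro!: sum.cong)
  qed
  define S where "S = (\<lambda>i. (\<Sum>j\<in>UNIV. real (fst i j) * (real (fst i j) - 1) * vmonom ((fst i)(j := fst i j - 2)) \<xi>)
      - real (N i) * (real (N i) + real CARD('a) - 2) * vmonom (fst i) \<xi>)"
  have lb: "laplace_beltrami (\<lambda>\<zeta>. restrict P (surf l) (t *\<^sub>R \<zeta>, y)) \<xi> =
      (\<Sum>i\<in>K. c i * (t ^ N i * vmonom (snd i) (adapt l y)) * S i)"
    using laplace_beltrami_monoms[OF f \<xi>] unfolding S_def N_def by simp
  have "D_op \<kappa> l (restrict P (surf l)) (x, y) =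
      ((\<Sum>j\<in>UNIV - {l}. y $ j * D2 j j + (\<kappa> $ j + 1 - y $ j) * D1 j)
      + (t * D2 l l + (real CARD('a) - 1 - t) * D1 l))
      + 1 / t * (\<Sum>i\<in>K. c i * (t ^ N i * vmonom (snd i) (adapt l y)) * S i)"
    unfolding D_op_def prod.case Let_def \<xi>_def[symmetric] U_def[symmetric] t_def[symmetric] lb d
    unfolding t_def
      adapted_operator[where ?D1.0 = D1 and ?D2.0 = D2 and l = l and y = y and \<kappa> = \<kappa>
        and d = "real CARD('a)", OF sym]
    by (rule refl)
  also have "\<dots> = (\<Sum>i\<in>K. C i * ((\<Sum>j\<in>UNIV - {l}. y $ j * ddmonom l j j (\<gamma> i) y + (\<kappa> $ j + 1 - y $ j) * dmonom l j (\<gamma> i) y)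
        + (t * ddmonom l l l (\<gamma> i) y + (real CARD('a) - 1 - t) * dmonom l l (\<gamma> i) y))
      + 1 / t * (c i * (t ^ N i * vmonom (snd i) (adapt l y)) * S i))"
    unfolding D1_def D2_def linear_combination_swap
    unfolding sum_distrib_left[of "1 / t"] sum.distrib[symmetric] by (rule refl)
  also have "\<dots> = (\<Sum>i\<in>K. c i * gen_monom \<kappa> l i (x, y))"
  proof (rule sum.cong[OF refl])
    fix i
    show "C i * ((\<Sum>j\<in>UNIV - {l}. y $ j * ddmonom l j j (\<gamma> i) y + (\<kappa> $ j + 1 - y $ j) * dmonom l j (\<gamma> i) y)
        + (t * ddmonom l l l (\<gamma> i) y + (real CARD('a) - 1 - t) * dmonom l l (\<gamma> i) y))
      + 1 / t * (c i * (t ^ N i * vmonom (snd i) (adapt l y)) * S i) = c i * gen_monom \<kappa> l i (x, y)"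
      using gen_monom_polar[where \<alpha> = "fst i" and \<beta> = "snd i" and l = l and \<kappa> = \<kappa> and \<xi> = \<xi>, OF assms(3),
        symmetric]
      unfolding C_def x \<gamma>_def S_def N_def t_def prod.collapse
      by (simp only: mult.assoc distrib_left mult.left_commute[of _ "c i"])
  qed
  finally show ?thesis .
qed

text \<open>
  Every term that would have too large a degree or a truncated exponent has coefficient \<open>0\<close>; adding \<open>n\<close>
  times the identity removes the leading term in degree \<open>n\<close>.
\<close>

lemma polynomials_gen_shift:
  fixes i :: "('a::finite \<Rightarrow> nat) \<times> ('b::finite \<Rightarrow> nat)"
  assumes i: "i \<in> multi_indices n"
  shows "(\<lambda>p. gen_monom \<kappa> l i p + real n * amonom l i p) \<in> polynomials (n - 1)"
proof -
  obtain \<alpha> \<beta> where ab: "i = (\<alpha>, \<beta>)" by (cases i)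
  have deg: "sum \<alpha> UNIV + sum \<beta> UNIV \<le> n" using i by (simp add: ab multi_indices_def)
  have scaled: "(\<lambda>p :: (real ^ 'a) \<times> (real ^ 'b). k * f p) \<in> polynomials m" if "k = 0 \<or> f \<in> polynomials m" for k f m
    using that polynomials_const[of 0 m] by (auto intro: polynomials_scale)
  have L: "(\<lambda>p. real (\<beta> j) * k * amonom l (\<alpha>, \<beta>(j := \<beta> j - 1)) p) \<in> polynomials (n - 1)" for j k
  proof (rule scaled, cases "\<beta> j = 0")
    case False
    then have "amonom l (\<alpha>, \<beta>(j := \<beta> j - 1)) \<in> polynomials (n - 1)"
      using deg sum_upd[of \<beta> j "\<beta> j - 1"] by (intro polynomials_amonom) (simp del: fun_upd_apply)
    then show "real (\<beta> j) * k = 0 \<or> amonom l (\<alpha>, \<beta>(j := \<beta> j - 1)) \<in> polynomials (n - 1)" ..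
  qed simp
  have S: "(\<lambda>p. real (\<alpha> j) * (real (\<alpha> j) - 1) * amonom l (\<alpha>(j := \<alpha> j - 2), \<beta>(l := \<beta> l + 1)) p) \<in> polynomials (n - 1)" for j
  proof (rule scaled, cases "\<alpha> j \<ge> 2")
    case True
    then have "amonom l (\<alpha>(j := \<alpha> j - 2), \<beta>(l := \<beta> l + 1)) \<in> polynomials (n - 1)"
      using deg sum_upd[of \<alpha> j "\<alpha> j - 2"] sum_upd[of \<beta> l "\<beta> l + 1"]
      by (intro polynomials_amonom) (simp del: fun_upd_apply)
    then show "real (\<alpha> j) * (real (\<alpha> j) - 1) = 0 \<or> amonom l (\<alpha>(j := \<alpha> j - 2), \<beta>(l := \<beta> l + 1)) \<in> polynomials (n - 1)" ..
  next
    case False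
    then have "\<alpha> j = 0 \<or> \<alpha> j = 1" by auto
    then show "real (\<alpha> j) * (real (\<alpha> j) - 1) = 0 \<or> amonom l (\<alpha>(j := \<alpha> j - 2), \<beta>(l := \<beta> l + 1)) \<in> polynomials (n - 1)"
      by auto
  qed
  have T: "(\<lambda>p. (real n - real (sum \<alpha> UNIV + sum \<beta> UNIV)) * amonom l (\<alpha>, \<beta>) p) \<in> polynomials (n - 1)"
  proof (rule scaled, cases "sum \<alpha> UNIV + sum \<beta> UNIV = n")
    case False
    then have "amonom l (\<alpha>, \<beta>) \<in> polynomials (n - 1)"
      using deg by (intro polynomials_amonom) simp
    then show "real n - real (sum \<alpha> UNIV + sum \<beta> UNIV) = 0 \<or> amonom l (\<alpha>, \<beta>) \<in> polynomials (n - 1)" ..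
  qed simp
  have "(\<lambda>p. low_terms \<kappa> l (\<lambda>\<alpha> \<beta>. amonom l (\<alpha>, \<beta>) p) i
      + (real n - real (sum \<alpha> UNIV + sum \<beta> UNIV)) * amonom l (\<alpha>, \<beta>) p) \<in> polynomials (n - 1)"
    unfolding low_terms_def ab prod.case
    by (intro polynomials_add polynomials_sum L S T)
  then show ?thesis
    by (simp add: gen_monom_def ab algebra_simps)
qed

lemma polynomials_gen:
  assumes "i \<in> multi_indices n"
  shows "gen_monom \<kappa> l i \<in> polynomials n"
proof -
  have "(\<lambda>p. (gen_monom \<kappa> l i p + real n * amonom l i p) + (- real n) * amonom l i p) \<in> polynomials n"
    using assms
    by (intro polynomials_add polynomials_scale polynomials_mono[OF polynomials_gen_shift] polynomials_amonom)
      (auto simp: multi_indices_def)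
  then show ?thesis by simp
qed

lemma weight_measurable: "(\<lambda>p :: (real ^ 'a) \<times> (real ^ 'b). weight \<kappa> l (snd p)) \<in> borel_measurable borel"
proof -
  have [measurable]: "(\<lambda>p :: (real ^ 'a) \<times> (real ^ 'b). snd p $ i) \<in> borel_measurable borel" for i
    by (intro borel_measurable_continuous_onI continuous_intros)
  show ?thesis
    unfolding weight_def coord_sum_def by measurable
qed

lemma weight_pos:
  assumes "\<And>i. i \<noteq> l \<Longrightarrow> y $ i > 0" "coord_sum y > 0"
  shows "weight \<kappa> l y > 0"
proof -
  have "y $ i \<noteq> 0" if "i \<noteq> l" for i
    using assms(1)[OF that] by simp
  then show ?thesis
    using assms(2) unfolding weight_def by (intro mult_pos_pos prod_pos) auto
qed

text \<open>
  If \<open>R\<close> does not vanish at a point of the surface, then by continuity it does not vanish over a small open set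
  in the variable \<open>x\<close> times a small box in the variables \<open>y'\<close>.  The box extends from \<open>y'\<close> in the positive
  directions only, so that points with some \<open>y\<^sub>j = 0\<close> need no separate treatment, and the origin is
  removed from the open set.  On the resulting set of positive measure the weight is positive, and so is the
  integrand.
\<close>

lemma vanishes_if_weighted_square_integral_eq_0:
  fixes R :: "(real ^ 'a) \<times> (real ^ 'b) \<Rightarrow> real"
  assumes R: "continuous_on UNIV R"
    and I: "has_bochner_integral (graph_coords l)
      (\<lambda>p. indicator (surf l) (graph_map l p) *
        (R (graph_map l p) * R (graph_map l p) * weight \<kappa> l (snd (graph_map l p)))) 0"
    and p: "(x, y) \<in> surf l" and t: "coord_sum y > 0"
  shows "R (x, y) = 0"
proof (rule ccontr)
  assume nz: "R (x, y) \<noteq> 0"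
  let ?f = "\<lambda>p. indicator (surf l) (graph_map l p) *
      (R (graph_map l p) * R (graph_map l p) * weight \<kappa> l (snd (graph_map l p)))"
  have wnn: "weight \<kappa> l z \<ge> 0" for z :: "real ^ 'b"
    unfolding weight_def by (intro mult_nonneg_nonneg prod_nonneg) auto
  have ae: "AE p in graph_coords l. ?f p = 0"
    using I integral_nonneg_eq_0_iff_AE[of "graph_coords l" ?f] wnn
    by (auto simp: has_bochner_integral_iff)
  \<comment> \<open>the coordinate \<open>l\<close> of \<open>snd q\<close> is ignored, which makes \<open>R\<close> composed with the graph map a function on an
    ordinary product of Euclidean spaces\<close>
  define \<Phi> where "\<Phi> = (\<lambda>q :: (real ^ 'a) \<times> (real ^ 'b).
    R (fst q, \<chi> j. if j = l then norm (fst q) - (\<Sum>i\<in>UNIV - {l}. snd q $ i) else snd q $ j))"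
  have "continuous_on UNIV (\<lambda>q :: (real ^ 'a) \<times> (real ^ 'b).
      (fst q, \<chi> j. if j = l then norm (fst q) - (\<Sum>i\<in>UNIV - {l}. snd q $ i) else snd q $ j))"
  proof (intro continuous_on_Pair continuous_on_vec_lambda)
    show "continuous_on UNIV (\<lambda>q :: (real ^ 'a) \<times> (real ^ 'b).
        if j = l then norm (fst q) - (\<Sum>i\<in>UNIV - {l}. snd q $ i) else snd q $ j)" for j
      by (cases "j = l") (auto intro!: continuous_intros)
  qed (intro continuous_intros)
  then have "continuous_on UNIV \<Phi>"
    unfolding \<Phi>_def by (rule continuous_on_compose2[OF R]) auto
  then have "open (\<Phi> -` (- {0}))"
    by (intro open_vimage) auto
  moreover have "(x, y) \<in> \<Phi> -` (- {0})"
  proof -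
    have "(\<chi> j. if j = l then norm x - (\<Sum>i\<in>UNIV - {l}. y $ i) else y $ j) = y"
      using p by (simp add: surf_def vec_eq_iff coord_sum_remove[of y l])
    with nz show ?thesis
      unfolding vimage_def mem_Collect_eq \<Phi>_def fst_conv snd_conv by simp
  qed
  ultimately obtain A B where AB: "open A" "x \<in> A" "open B" "y \<in> B" "A \<times> B \<subseteq> \<Phi> -` (- {0})"
    by (auto elim: open_prod_elim)
  then obtain e where e: "e > 0" "ball y e \<subseteq> B" by (meson openE)
  define \<delta> where "\<delta> = e / (real CARD('b) + 1)"
  have \<delta>: "\<delta> > 0" "real CARD('b) * \<delta> < e" using e by (simp_all add: \<delta>_def field_simps)
  define A' where "A' = A - {0}"
  define E where "E = (\<Pi>\<^sub>E j\<in>UNIV - {l}. {y $ j<..<y $ j + \<delta>})"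
  have nx: "x \<noteq> 0" using p t by (auto simp: surf_def)
  have nonzero: "?f q \<noteq> 0" if q: "q \<in> A' \<times> E" for q
  proof -
    obtain x' \<eta> where q': "q = (x', \<eta>)" by (cases q)
    have \<eta>: "y $ j < \<eta> j" "\<eta> j < y $ j + \<delta>" if "j \<noteq> l" for j
      using q that by (auto simp: q' E_def PiE_iff)
    define v where "v = (\<chi> j. if j = l then y $ l else \<eta> j)"
    have "norm (v - y) \<le> (\<Sum>j\<in>UNIV. \<bar>(v - y) $ j\<bar>)" by (rule norm_le_l1_cart)
    also have "\<dots> \<le> (\<Sum>j\<in>(UNIV :: 'b set). \<delta>)"
    proof (rule sum_mono)
      show "\<bar>(v - y) $ j\<bar> \<le> \<delta>" for j
        using \<eta>[of j] \<delta>(1) by (cases "j = l") (simp_all add: v_def)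
    qed
    also have "\<dots> < e" using \<delta> by simp
    finally have "v \<in> B" using e by (auto simp: dist_norm norm_minus_commute)
    then have "\<Phi> (x', v) \<noteq> 0" using AB q by (auto simp: q' A'_def)
    then have "R (x', \<chi> j. if j = l then norm x' - (\<Sum>i\<in>UNIV - {l}. v $ i) else v $ j) \<noteq> 0"
      unfolding \<Phi>_def fst_conv snd_conv .
    moreover have "(x', \<chi> j. if j = l then norm x' - (\<Sum>i\<in>UNIV - {l}. v $ i) else v $ j) = graph_map l q"
      by (auto simp: q' graph_map_def v_def vec_eq_iff intro!: sum.cong)
    ultimately have "R (graph_map l q) \<noteq> 0" by simp
    moreover have "\<eta> j > 0" if "j \<noteq> l" for j
      using \<eta>(1)[OF that] p that by (auto simp: surf_def R_Sigma_def intro: le_less_trans)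
    then have "graph_map l q \<in> surf l" "weight \<kappa> l (snd (graph_map l q)) > 0"
      using q by (auto simp: graph_map_in_surf graph_map_nth q' A'_def intro!: weight_pos less_imp_le)
    ultimately show ?thesis by simp
  qed
  interpret product_sigma_finite "\<lambda>_ :: 'b. lborel :: real measure" ..
  interpret F: sigma_finite_measure "\<Pi>\<^sub>M i\<in>UNIV - {l}. (lborel :: real measure)"
    by (rule sigma_finite) simp
  have sets: "A' \<in> sets lborel" "E \<in> sets (\<Pi>\<^sub>M i\<in>UNIV - {l}. lborel)"
    using AB unfolding A'_def E_def by (auto intro!: sets_PiM_I_finite)
  have "AE q in graph_coords l. q \<notin> A' \<times> E"
    using ae by eventually_elim (use nonzero in blast)
  then have "emeasure (graph_coords l) (A' \<times> E) = 0"
    using sets by (subst (asm) AE_iff_null_sets[symmetric]) auto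
  then have "emeasure lborel A' * emeasure (\<Pi>\<^sub>M i\<in>UNIV - {l}. lborel) E = 0"
    using sets by (simp add: F.emeasure_pair_measure_Times)
  moreover have "emeasure (\<Pi>\<^sub>M i\<in>UNIV - {l}. lborel) E = (\<Prod>j\<in>UNIV - {l}. ennreal \<delta>)"
    unfolding E_def using \<delta> by (subst emeasure_PiM) auto
  moreover have "emeasure lborel A' \<noteq> 0"
  proof
    assume "emeasure lborel A' = 0"
    then have "A' \<in> null_sets lborel" using sets by auto
    then have "negligible A'"
      by (simp add: negligible_iff_null_sets null_sets_completionI)
    moreover have "open A'" "x \<in> A'" using AB nx by (auto simp: A'_def)
    ultimately show False using open_not_negligible by blast
  qed
  ultimately show False using \<delta> by (simp add: prod_zero_iff)
qed

text \<open>
  Symmetry of \<open>D + s\<close>, where primes denote images under it.  The existence of the integrals is part of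
  the conclusion, since an integral with value \<open>0\<close> alone would not exclude an integrand that is not
  integrable.
\<close>

lemma gen_shift_symmetric:
  fixes \<kappa> :: "real ^ 'b" and l :: 'b and m n :: nat
    and c e :: "('a::finite \<Rightarrow> nat) \<times> ('b \<Rightarrow> nat) \<Rightarrow> real" and s :: real
  assumes dim: "CARD('a) \<ge> 2" and \<kappa>: "\<And>i. i \<noteq> l \<Longrightarrow> \<kappa> $ i > -1" and \<kappa>l: "\<kappa> $ l = -1"
    and P: "P = (\<lambda>p. \<Sum>i\<in>multi_indices m. c i * amonom l i p)"
    and P': "P' = (\<lambda>p. \<Sum>i\<in>multi_indices m. c i * (gen_monom \<kappa> l i p + s * amonom l i p))"
    and Q: "Q = (\<lambda>p. \<Sum>j\<in>multi_indices n. e j * amonom l j p)"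
    and Q': "Q' = (\<lambda>p. \<Sum>j\<in>multi_indices n. e j * (gen_monom \<kappa> l j p + s * amonom l j p))"
  obtains v where
    "has_bochner_integral (graph_coords l) (\<lambda>p. indicator (surf l) (graph_map l p) *
      (P' (graph_map l p) * Q (graph_map l p) * weight \<kappa> l (snd (graph_map l p)))) v"
    "has_bochner_integral (graph_coords l) (\<lambda>p. indicator (surf l) (graph_map l p) *
      (P (graph_map l p) * Q' (graph_map l p) * weight \<kappa> l (snd (graph_map l p)))) v"
proof -
  let ?M = "\<lambda>i j. moment \<kappa> l (\<lambda>k. fst i k + fst j k) (\<lambda>k. snd i k + snd j k)"
  let ?I = "\<lambda>f p. indicator (surf l) (graph_map l p) * (f (graph_map l p) * weight \<kappa> l (snd (graph_map l p)))"
  let ?G = "\<lambda>i p. gen_monom \<kappa> l i p + s * amonom l i p"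
  define B where "B = (\<lambda>i j :: ('a \<Rightarrow> nat) \<times> ('b \<Rightarrow> nat). gen_form \<kappa> l i j + s * ?M i j)"
  have sym: "B i j = B j i" for i j :: "('a \<Rightarrow> nat) \<times> ('b \<Rightarrow> nat)"
    using gen_form_commute[OF dim \<kappa>, of l i j] by (simp add: B_def add.commute)
  have base: "has_bochner_integral (graph_coords l) (?I (\<lambda>q. ?G i q * amonom l j q)) (B i j)"
    for i j :: "('a \<Rightarrow> nat) \<times> ('b \<Rightarrow> nat)"
  proof -
    have M: "has_bochner_integral (graph_coords l) (?I (\<lambda>q. amonom l i q * amonom l j q)) (?M i j)"
    proof -
      have "amonom l i q * amonom l j q = amonom l (\<lambda>k. fst i k + fst j k, \<lambda>k. snd i k + snd j k) q" for q
        using amonom_mult[of l "fst i" "snd i" q j] by simp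
      then show ?thesis
        using weighted_monom_integral[OF dim \<kappa> \<kappa>l] by simp
    qed
    have "has_bochner_integral (graph_coords l)
        (\<lambda>p. ?I (\<lambda>q. gen_monom \<kappa> l i q * amonom l j q) p + s * ?I (\<lambda>q. amonom l i q * amonom l j q) p) (B i j)"
      unfolding B_def
      by (intro has_bochner_integral_add has_bochner_integral_mult_right M
          has_bochner_integral_gen_form[OF dim \<kappa> \<kappa>l])
    then show ?thesis by (simp add: algebra_simps)
  qed
  have base': "has_bochner_integral (graph_coords l) (?I (\<lambda>q. ?G j q * amonom l i q)) (B i j)"
    for i j :: "('a \<Rightarrow> nat) \<times> ('b \<Rightarrow> nat)"
    unfolding sym[of i j] by (rule base)
  let ?v = "\<Sum>i\<in>multi_indices m. \<Sum>j\<in>multi_indices n. c i * e j * B i j"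
  show ?thesis
  proof (rule that)
    have "has_bochner_integral (graph_coords l)
        (\<lambda>p. \<Sum>i\<in>multi_indices m. \<Sum>j\<in>multi_indices n. c i * e j * ?I (\<lambda>q. ?G i q * amonom l j q) p) ?v"
      by (intro has_bochner_integral_sum has_bochner_integral_mult_right base)
    moreover have "(\<Sum>i\<in>multi_indices m. \<Sum>j\<in>multi_indices n. c i * e j * ?I (\<lambda>q. ?G i q * amonom l j q) p)
        = ?I (\<lambda>q. P' q * Q q) p" for p
      unfolding P' Q sum_product unfolding sum_distrib_left sum_distrib_right
      by (intro sum.cong refl) (simp add: mult_ac)
    ultimately show "has_bochner_integral (graph_coords l) (?I (\<lambda>q. P' q * Q q)) ?v" by simp
    have "has_bochner_integral (graph_coords l)
        (\<lambda>p. \<Sum>i\<in>multi_indices m. \<Sum>j\<in>multi_indices n. c i * e j * ?I (\<lambda>q. ?G j q * amonom l i q) p) ?v"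
      by (intro has_bochner_integral_sum has_bochner_integral_mult_right base')
    moreover have "(\<Sum>i\<in>multi_indices m. \<Sum>j\<in>multi_indices n. c i * e j * ?I (\<lambda>q. ?G j q * amonom l i q) p)
        = ?I (\<lambda>q. P q * Q' q) p" for p
      unfolding P Q' sum_product unfolding sum_distrib_left sum_distrib_right
      by (intro sum.cong refl) (simp add: mult_ac)
    ultimately show "has_bochner_integral (graph_coords l) (?I (\<lambda>q. P q * Q' q)) ?v" by simp
  qed
qed

theorem theorem7p7:
  fixes \<kappa> :: "real ^ 'b" and l :: 'b and n :: nat
    and u :: "(real ^ 'a) \<times> (real ^ 'b) \<Rightarrow> real"
  assumes "CARD('a) \<ge> 2"
    and "\<And>i. i \<noteq> l \<Longrightarrow> \<kappa> $ i > -1"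
    and "\<kappa> $ l = -1"
    and "u \<in> orth_polys n l (weight \<kappa> l)"
  shows "\<forall>(x, y)\<in>surf l. coord_sum y > 0 \<longrightarrow> D_op \<kappa> l u (x, y) = - real n * u (x, y)"
proof -
  obtain P where u: "u = restrict P (surf l)" and P: "P \<in> polynomials n"
    and orth: "\<And>m Q. m < n \<Longrightarrow> Q \<in> polynomials m \<Longrightarrow>
      set_lebesgue_integral (surface_measure l) (surf l) (\<lambda>p. P p * Q p * weight \<kappa> l (snd p)) = 0"
    using assms(4) unfolding orth_polys_def by blast
  from polynomial_amonom_expansion[OF P, of l] obtain c
    where c: "P = (\<lambda>p. \<Sum>i\<in>multi_indices n. c i * amonom l i p)" .
  define R where "R = (\<lambda>p. \<Sum>i\<in>multi_indices n. c i * (gen_monom \<kappa> l i p + real n * amonom l i p))"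
  have R: "R \<in> polynomials (n - 1)"
    unfolding R_def by (intro polynomials_sum polynomials_scale polynomials_gen_shift)
  have "R (x, y) = 0" if p: "(x, y) \<in> surf l" "coord_sum y > 0" for x y
  proof (cases "n = 0")
    case True
    \<comment> \<open>there are no polynomials of degree less than \<open>0\<close> to test with, but constants are annihilated\<close>
    have "gen_monom \<kappa> l i q = 0" if "i \<in> multi_indices n" for i and q :: "(real ^ 'a) \<times> (real ^ 'b)"
      using that True by (auto simp: multi_indices_def gen_monom_def low_terms_def)
    with True show ?thesis by (simp add: R_def)
  next
    case False
    from polynomial_amonom_expansion[OF R, of l] obtain e
      where e: "R = (\<lambda>p. \<Sum>j\<in>multi_indices (n - 1). e j * amonom l j p)" .
    define R' where "R' = (\<lambda>p. \<Sum>j\<in>multi_indices (n - 1). e j * (gen_monom \<kappa> l j p + real n * amonom l j p))"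
    have R': "R' \<in> polynomials (n - 1)"
      unfolding R'_def
      by (intro polynomials_sum polynomials_scale polynomials_add polynomials_gen polynomials_amonom)
        (auto simp: multi_indices_def)
    obtain v where v1: "has_bochner_integral (graph_coords l) (\<lambda>p. indicator (surf l) (graph_map l p) *
        (R (graph_map l p) * R (graph_map l p) * weight \<kappa> l (snd (graph_map l p)))) v"
      and v2: "has_bochner_integral (graph_coords l) (\<lambda>p. indicator (surf l) (graph_map l p) *
        (P (graph_map l p) * R' (graph_map l p) * weight \<kappa> l (snd (graph_map l p)))) v"
      by (rule gen_shift_symmetric[OF assms(1-3) c R_def e R'_def])
    have "(\<lambda>p. P p * R' p * weight \<kappa> l (snd p)) \<in> borel_measurable borel"
      by (intro borel_measurable_times weight_measurable borel_measurable_continuous_onI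
          continuous_on_polynomial[OF P] continuous_on_polynomial[OF R'])
    from surface_integral_graph(2)[OF this v2]
    have "sqrt (1 + real CARD('b)) * v = 0"
      using orth[of "n - 1" R'] R' False by simp
    then have "v = 0" by simp
    with v1 show ?thesis
      using vanishes_if_weighted_square_integral_eq_0[OF continuous_on_polynomial[OF R] _ p] by simp
  qed
  moreover have "D_op \<kappa> l u (x, y) = R (x, y) - real n * u (x, y)"
    if p: "(x, y) \<in> surf l" "coord_sum y > 0" for x y
  proof -
    have "u (x, y) = (\<Sum>i\<in>multi_indices n. c i * amonom l i (x, y))"
      using p by (simp add: u c)
    then show ?thesis
      unfolding u[unfolded c] D_op_amonoms[OF p]
      by (simp add: R_def p distrib_left sum.distrib sum_distrib_left mult_ac)
  qed
  ultimately show ?thesis by auto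
qed

end
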